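(* Let $k\ge 0$ be an integer and $\delta\in(-1,\infty)$. Put $b_m:=k-m+1+\delta(k-m)$ for $m=0,\dots,k$ and $\tau:=k+2+\delta(k+1)$. Let $(p_{i_0,\dots,i_k})$, indexed by integers $1\le i_k<\cdots<i_0$, be defined recursively by $$ \begin{aligned} p_{i_0,\dots,i_k} &= \frac{i_k-1+\delta}{\tau}\, p_{i_0-1,\dots,i_k-1}\\ &\quad+\sum_{m=0}^{k-1}\frac{(i_m-1-k+m)b_m-(i_{m+1}-k+m+1)b_{m+1}}{\tau}\,p_{i_0-1,\dots,i_m-1,i_{m+1},\dots,i_k}\\ &\quad-\frac{(i_0-k)b_0+\delta}{\tau}\,p_{i_0,\dots,i_k}+\mathbf 1\{i_\ell=k-\ell+1,\ \ell=0,\dots,k\},\qquad 1\le i_k<\cdots<i_0, \end{aligned} $$ where $p_{j_0,\dots,j_k}$ is interpreted as $0$ whenever the condition $1\le j_k<\cdots<j_0$ fails. Then $(p_{i_0,\dots,i_k})_{1\le i_k<\cdots<i_0}$ is a probability mass function, and for every $1\le i_k<\cdots<i_0$, with $N_n(i_0,\dots,i_k)$ the degree counts of the preferential attachment complex $G_n$ with parameters $k,\delta$, $$ p^{(n)}_{i_0,\dots,i_k}:=\frac{N_n(i_0,\dots,i_k)}{1+(n+1)(k+1)}\longrightarrow p_{i_0,\dots,i_k}\quad\text{almost surely as } n\to\infty . $$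
   Context: An (abstract) simplicial complex is a collection of nonempty finite sets closed under taking nonempty subsets; an element $\sigma$ is a simplex of dimension $|\sigma|-1$ (an $m$-simplex has $m+1$ elements). The $m$-degree of an $m$-simplex $\sigma$ in a complex is the number of $(m+1)$-simplices of the complex containing $\sigma$. Preferential attachment complex with parameters $k\in\{0,1,2,\dots\}$ and $\delta>-1$: a random sequence $G_0,G_1,\dots$ of simplicial complexes. $G_0$ consists of all nonempty subsets of $\{1,\dots,k+2\}$. Let $\mathcal F_{m,n}$ be the set of $m$-simplices of $G_n$ and $D^{(m)}_n(\sigma)$ the $m$-degree of $\sigma\in\mathcal F_{m,n}$ in $G_n$. For $n\ge1$, given $G_0,\dots,G_{n-1}$, a $k$-simplex $\sigma\in\mathcal F_{k,n-1}$ is chosen with probability $$\frac{D^{(k)}_{n-1}(\sigma)+\delta}{\sum_{\tau'\in\mathcal F_{k,n-1}}\big(D^{(k)}_{n-1}(\tau')+\delta\big)},$$ and $G_n$ is obtained from $G_{n-1}$ by adding the $(k+1)$-simplex $\sigma\cup\{n+k+2\}$ together with all its nonempty subsets. One has $|\mathcal F_{k,n}|=1+(n+1)(k+1)$. Degree counts: $$N_n(i_0,\dots,i_k):=\sum_{\sigma\in\mathcal F_{k,n}}\mathbf 1\big\{D_n^{(m)}(\{v_{k-m},\dots,v_k\})=i_m,\ m=0,\dots,k\big\},$$ where $\sigma=\{v_0,\dots,v_k\}$ with $v_0<\cdots<v_k$. *)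

theory Defs
  imports "HOL-Probability.Probability"
begin

definition simplicial_complex :: "nat set set \<Rightarrow> bool" where
  "simplicial_complex K \<longleftrightarrow>
     (\<forall>\<sigma>\<in>K. finite \<sigma> \<and> \<sigma> \<noteq> {} \<and> (\<forall>\<rho>\<subseteq>\<sigma>. \<rho> \<noteq> {} \<longrightarrow> \<rho> \<in> K))"

definition simplices :: "nat \<Rightarrow> nat set set \<Rightarrow> nat set set" where
  "simplices m K = {\<sigma> \<in> K. card \<sigma> = m + 1}"

definition face_degree :: "nat \<Rightarrow> nat set set \<Rightarrow> nat set \<Rightarrow> nat" where
  "face_degree m K \<sigma> = card {\<rho> \<in> simplices (m + 1) K. \<sigma> \<subseteq> \<rho>}"

definition full_simplex :: "nat set \<Rightarrow> nat set set" where
  "full_simplex A = {\<rho>. \<rho> \<subseteq> A \<and> \<rho> \<noteq> {}}"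

text \<open>
  The law of the process is specified by its elementary conditional probabilities
  given each history \<open>G 0 = h 0, \<dots>, G n = h n\<close> of positive probability.
  The complexes range over the countable set of finite simplicial complexes on the naturals.
  The chosen simplex \<open>\<sigma>\<close> needs no random variable of its own: distinct choices of
  \<open>\<sigma>\<close> lead to distinct complexes, since the added vertex is new.
\<close>

locale preferential_attachment_complex = prob_space M
  for M :: "'a measure" +
  fixes k :: nat and \<delta> :: real and G :: "nat \<Rightarrow> 'a \<Rightarrow> nat set set"
  assumes random_complex:
    "random_variable (count_space {K. finite K \<and> simplicial_complex K}) (G n)"
  and initial: "AE \<omega> in M. G 0 \<omega> = full_simplex {1..k + 2}"
  and attachment:
    "\<lbrakk>\<P>(\<omega> in M. \<forall>j\<le>n. G j \<omega> = h j) > 0; \<sigma> \<in> simplices k (h n)\<rbrakk> \<Longrightarrow>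
       \<P>(\<omega> in M. G (n + 1) \<omega> = h n \<union> full_simplex (insert ((n + 1) + k + 2) \<sigma>)
            \<bar> \<forall>j\<le>n. G j \<omega> = h j)
       = (real (face_degree k (h n) \<sigma>) + \<delta>)
         / (\<Sum>\<sigma>'\<in>simplices k (h n). real (face_degree k (h n) \<sigma>') + \<delta>)"

text \<open>
  A tuple \<open>(i\<^sub>0, \<dots>, i\<^sub>k)\<close> is a list \<open>is\<close> of length \<open>k + 1\<close> with \<open>is ! m = i\<^sub>m\<close>.
\<close>

definition degree_indices :: "nat \<Rightarrow> nat list set" where
  "degree_indices k = {is. length is = k + 1 \<and> sorted_wrt (>) is \<and> 1 \<le> is ! k}"

text \<open>
  If \<open>\<sigma> = {v\<^sub>0 < \<dots> < v\<^sub>k}\<close>, dropping \<open>k - m\<close> entries of its sorted list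
  leaves the face \<open>{v\<^bsub>k-m\<^esub>, \<dots>, v\<^sub>k}\<close>.
\<close>

definition degree_count :: "nat \<Rightarrow> nat set set \<Rightarrow> nat list \<Rightarrow> nat" where
  "degree_count k K is = card {\<sigma> \<in> simplices k K.
     \<forall>m\<le>k. face_degree m K (set (drop (k - m) (sorted_list_of_set \<sigma>))) = is ! m}"

definition b_coeff :: "nat \<Rightarrow> real \<Rightarrow> nat \<Rightarrow> real" where
  "b_coeff k \<delta> m = real k - real m + 1 + \<delta> * (real k - real m)"

definition tau :: "nat \<Rightarrow> real \<Rightarrow> real" where
  "tau k \<delta> = real k + 2 + \<delta> * (real k + 1)"

text \<open>
  Lower the first \<open>j\<close> entries by one.  Truncated subtraction is harmless: entries of
  elements of \<open>degree_indices k\<close> are positive, and a resulting \<open>0\<close> is not admissible.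
\<close>

definition lower :: "nat \<Rightarrow> nat list \<Rightarrow> nat list" where
  "lower j is = map (\<lambda>i. i - 1) (take j is) @ drop j is"

definition zero_ext :: "nat \<Rightarrow> (nat list \<Rightarrow> real) \<Rightarrow> nat list \<Rightarrow> real" where
  "zero_ext k p js = (if js \<in> degree_indices k then p js else 0)"

definition degree_recursion :: "nat \<Rightarrow> real \<Rightarrow> (nat list \<Rightarrow> real) \<Rightarrow> bool" where
  "degree_recursion k \<delta> p \<longleftrightarrow> (\<forall>is\<in>degree_indices k.
     p is =
       (real (is ! k) - 1 + \<delta>) / tau k \<delta> * zero_ext k p (lower (k + 1) is)
     + (\<Sum>m<k. ((real (is ! m) - 1 - real k + real m) * b_coeff k \<delta> m
                 - (real (is ! (m + 1)) - real k + real m + 1) * b_coeff k \<delta> (m + 1))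
               / tau k \<delta> * zero_ext k p (lower (m + 1) is))
     - ((real (is ! 0) - real k) * b_coeff k \<delta> 0 + \<delta>) / tau k \<delta> * p is
     + of_bool (\<forall>l\<le>k. is ! l = k - l + 1))"

text \<open>
  The recursion determines \<open>p\<close>: the right-hand side refers to \<open>p is\<close> only with a
  coefficient that can be moved to the left, and otherwise to tuples with smaller first entry.
\<close>

lemma sorted_gt_nth_lower_bound:
  assumes "is \<in> degree_indices k" "l \<le> k"
  shows "is ! l \<ge> k - l + 1"
  using assms(2)
proof (induction l rule: inc_induct)
  case base
  then show ?case using assms(1) by (simp add: degree_indices_def)
next
  case (step l)
  have "is ! Suc l < is ! l"
    using assms(1) step by (auto simp: degree_indices_def sorted_wrt_iff_nth_less)
  then show ?case using step by linarith
qed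

lemma lower_nth_0_less:
  assumes "is \<in> degree_indices k"
  shows "lower (Suc j) is ! 0 < is ! 0"
  using sorted_gt_nth_lower_bound[OF assms, of 0] assms
  by (cases "is") (auto simp: lower_def degree_indices_def)

lemma recursion_factor_pos:
  assumes "is \<in> degree_indices k" "\<delta> > -1"
  shows "1 + ((real (is ! 0) - real k) * b_coeff k \<delta> 0 + \<delta>) / tau k \<delta> > 0"
proof -
  have d: "\<delta> * real k \<ge> - real k"
    using mult_right_mono[of "-1" \<delta> "real k"] assms(2) by simp
  have "tau k \<delta> > 0" using d assms(2) by (simp add: tau_def algebra_simps)
  moreover have "b_coeff k \<delta> 0 \<ge> 1" using d by (simp add: b_coeff_def)
  moreover have "real (is ! 0) - real k \<ge> 1"
    using sorted_gt_nth_lower_bound[OF assms(1), of 0] by simp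
  ultimately have "(real (is ! 0) - real k) * b_coeff k \<delta> 0 \<ge> 1"
    by (metis mult_mono' mult_1 zero_le_one)
  then have "(real (is ! 0) - real k) * b_coeff k \<delta> 0 + \<delta> > 0" using assms(2) by linarith
  then show ?thesis using \<open>tau k \<delta> > 0\<close> by (simp add: add_pos_pos)
qed

function limit_mass :: "nat \<Rightarrow> real \<Rightarrow> nat list \<Rightarrow> real" where
  "limit_mass k \<delta> is = (if is \<in> degree_indices k then
     ((real (is ! k) - 1 + \<delta>) / tau k \<delta> * limit_mass k \<delta> (lower (Suc k) is)
     + (\<Sum>m<k. ((real (is ! m) - 1 - real k + real m) * b_coeff k \<delta> m
                 - (real (is ! (m + 1)) - real k + real m + 1) * b_coeff k \<delta> (m + 1))
               / tau k \<delta> * limit_mass k \<delta> (lower (Suc m) is))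
     + of_bool (\<forall>l\<le>k. is ! l = k - l + 1))
     / (1 + ((real (is ! 0) - real k) * b_coeff k \<delta> 0 + \<delta>) / tau k \<delta>) else 0)"
  by auto
termination
proof (relation "Wellfounded.measure (\<lambda>(k, \<delta>, is). is ! 0)", goal_cases)
  case (2 k \<delta> "is")
  then show ?case by (simp add: lower_nth_0_less)
next
  case (3 k \<delta> "is" m)
  then show ?case by (simp add: lower_nth_0_less)
qed auto

declare limit_mass.simps [simp del]

lemma degree_recursion_iff:
  assumes "\<delta> > -1"
  shows "degree_recursion k \<delta> p \<longleftrightarrow> (\<forall>is\<in>degree_indices k. p is = limit_mass k \<delta> is)"
proof -
  define R where "R p is =
       (real (is ! k) - 1 + \<delta>) / tau k \<delta> * zero_ext k p (lower (Suc k) is)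
     + (\<Sum>m<k. ((real (is ! m) - 1 - real k + real m) * b_coeff k \<delta> m
                 - (real (is ! (m + 1)) - real k + real m + 1) * b_coeff k \<delta> (m + 1))
               / tau k \<delta> * zero_ext k p (lower (Suc m) is))
     + of_bool (\<forall>l\<le>k. is ! l = k - l + 1)" for p "is"
  define c where
    "c is = ((real (is ! 0) - real k) * b_coeff k \<delta> 0 + \<delta>) / tau k \<delta>" for "is"
  have rec: "degree_recursion k \<delta> p \<longleftrightarrow>
      (\<forall>is\<in>degree_indices k. p is = R p is - c is * p is)" for p
    unfolding degree_recursion_def R_def c_def by (simp add: algebra_simps)
  have pos: "1 + c is > 0" if "is \<in> degree_indices k" for "is"
    using recursion_factor_pos[OF that assms] unfolding c_def .
  have solve: "x = r - c is * x \<longleftrightarrow> x = r / (1 + c is)" if "is \<in> degree_indices k" for x r "is"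
    using pos[OF that] by (auto simp: field_simps)
  have ext: "zero_ext k (limit_mass k \<delta>) = limit_mass k \<delta>"
    by (rule ext) (simp add: zero_ext_def limit_mass.simps)
  have lm: "limit_mass k \<delta> is = R (limit_mass k \<delta>) is / (1 + c is)"
    if "is \<in> degree_indices k" for "is"
    using that unfolding R_def c_def ext by (subst limit_mass.simps) simp
  have low: "R p is = R q is"
    if "is \<in> degree_indices k" "\<And>js. js \<in> degree_indices k \<Longrightarrow> js ! 0 < is ! 0 \<Longrightarrow> p js = q js"
    for p q "is"
  proof -
    have "lower (Suc j) is ! 0 < is ! 0" for j
      using that(1) by (rule lower_nth_0_less)
    then have "zero_ext k p (lower (Suc j) is) = zero_ext k q (lower (Suc j) is)" for j
      using that(2) by (simp add: zero_ext_def)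
    then show ?thesis by (simp add: R_def)
  qed
  show ?thesis
  proof
    assume p: "degree_recursion k \<delta> p"
    show "\<forall>is\<in>degree_indices k. p is = limit_mass k \<delta> is"
    proof
      fix "is" assume "is \<in> degree_indices k"
      then show "p is = limit_mass k \<delta> is"
      proof (induction "is ! 0" arbitrary: "is" rule: less_induct)
        case less
        have "R p is = R (limit_mass k \<delta>) is"
          using less by (intro low) auto
        then show ?case using p less.prems lm solve unfolding rec by metis
      qed
    qed
  next
    assume eq: "\<forall>is\<in>degree_indices k. p is = limit_mass k \<delta> is"
    have "R p is = R (limit_mass k \<delta>) is" if "is \<in> degree_indices k" for "is"
      using eq that by (intro low) auto
    then show "degree_recursion k \<delta> p"
      unfolding rec using eq lm solve by metis
  qed
qed

end

theory Submission
  imports Defs "HOL-Library.Discrete_Functions"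
begin

text \<open>
  For a face \<open>f\<close>, every choice of a simplex containing \<open>f\<close> adds one \<open>(k+1)\<close>-simplex, a fixed
  number of \<open>k\<close>-simplices and one unit of degree to \<open>f\<close>.  Hence the degree of \<open>f\<close> determines the
  probability that the next choice contains \<open>f\<close>, and the conditional expectation of the next degree
  counts is a linear function of the current ones, with the coefficients of the recursion.  Simplices
  with a given first index \<open>i\<^sub>0\<close> contribute boundedly many changes per step, so the martingale part has
  bounded orthogonal increments and obeys a strong law of large numbers; the remaining deterministic
  recursion is solved by induction on \<open>i\<^sub>0\<close>.

  For the total mass: every transition of the recursion raises \<open>i\<^sub>0\<close> by exactly one and the exit rate
  \<open>w\<^sub>l\<close> depends only on \<open>l = i\<^sub>0\<close>.  The mass \<open>s\<^sub>l\<close> of level \<open>l\<close> therefore satisfies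
  \<open>s\<^sub>k\<^sub>+\<^sub>1 + \<dots> + s\<^sub>l = 1 - w\<^sub>l s\<^sub>l\<close>; since \<open>w\<^sub>l\<close> grows linearly, divergence of the harmonic
  series forces \<open>w\<^sub>l s\<^sub>l \<rightarrow> 0\<close>.
\<close>

section \<open>Cofaces in reachable complexes\<close>

text \<open>The index tuples belong to chains of faces. The faces spanned by the m + 1 largest
  vertices of a k-simplex increase with m, so a chosen \<sigma> contains an initial segment of them
  and raises an initial segment of the tuple by one. The weight of the choices with a prescribed
  segment is a difference of two consecutive face weights; this is where the differences of
  \<open>b_coeff\<close> terms come from, and why they telescope to a rate that depends on the first
  index alone. The obstacle to a law of large numbers is that degrees are unbounded, so one choice
  can touch arbitrarily many simplices. The count of a fixed tuple only reacts through simplices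
  whose largest vertex has bounded degree, which restores a uniform bound. The law is given by
  elementary conditional probabilities, so conditional expectations are replaced by sums over the
  finitely many possible histories.\<close>

definition cofaces :: "nat \<Rightarrow> nat set set \<Rightarrow> nat set \<Rightarrow> nat set set" where
  "cofaces j K f = {\<rho> \<in> K. card \<rho> = j \<and> f \<subseteq> \<rho>}"

lemma simplices_eq_cofaces: "simplices m K = cofaces (m + 1) K {}"
  by (simp add: simplices_def cofaces_def)

lemma face_degree_eq_cofaces: "face_degree m K f = card (cofaces (m + 2) K f)"
  by (simp add: simplices_def cofaces_def face_degree_def conj_assoc)

definition attach :: "nat \<Rightarrow> nat set set \<Rightarrow> nat set \<Rightarrow> nat set set" where
  "attach v K \<sigma> = K \<union> full_simplex (insert v \<sigma>)"

text \<open>The deterministic shadow of the process: outside a null set, \<open>G n\<close> takes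
  only such values. Every combinatorial identity is proved for them, and probability enters only
  through the law of the choice.\<close>

inductive reachable :: "nat \<Rightarrow> nat \<Rightarrow> nat set set \<Rightarrow> bool" for k where
  initial: "reachable k 0 (full_simplex {1..k + 2})"
| step: "\<lbrakk>reachable k n K; \<sigma> \<in> simplices k K\<rbrakk>
    \<Longrightarrow> reachable k (Suc n) (attach (n + 1 + k + 2) K \<sigma>)"

lemma card_sets_between:
  assumes "finite A" "f \<subseteq> A" "card f \<le> j"
  shows "card {\<rho>. f \<subseteq> \<rho> \<and> \<rho> \<subseteq> A \<and> card \<rho> = j} = (card A - card f) choose (j - card f)"
proof -
  have fin: "finite f" using assms finite_subset by blast
  have "bij_betw (\<lambda>\<rho>. \<rho> - f) {\<rho>. f \<subseteq> \<rho> \<and> \<rho> \<subseteq> A \<and> card \<rho> = j}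
      {\<rho>. \<rho> \<subseteq> A - f \<and> card \<rho> = j - card f}"
  proof (rule bij_betw_byWitness[where f' = "\<lambda>\<rho>. \<rho> \<union> f"])
    show "(\<lambda>\<rho>. \<rho> \<union> f) ` {\<rho>. \<rho> \<subseteq> A - f \<and> card \<rho> = j - card f}
        \<subseteq> {\<rho>. f \<subseteq> \<rho> \<and> \<rho> \<subseteq> A \<and> card \<rho> = j}"
    proof safe
      fix \<rho> assume r: "\<rho> \<subseteq> A - f" "card \<rho> = j - card f"
      then have "finite \<rho>" "\<rho> \<inter> f = {}" using assms(1) finite_subset by blast+
      then show "card (\<rho> \<union> f) = j" using r fin assms by (simp add: card_Un_disjoint)
    qed (use assms in auto)
  qed (use fin in \<open>auto simp: card_Diff_subset\<close>)
  then have "card {\<rho>. f \<subseteq> \<rho> \<and> \<rho> \<subseteq> A \<and> card \<rho> = j}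
      = card {\<rho>. \<rho> \<subseteq> A - f \<and> card \<rho> = j - card f}"
    by (rule bij_betw_same_card)
  also have "\<dots> = (card A - card f) choose (j - card f)"
    using assms fin by (simp add: n_subsets card_Diff_subset)
  finally show ?thesis .
qed

lemma reachable_complex:
  assumes "reachable k n K"
  shows "finite K" "\<rho> \<in> K \<Longrightarrow> \<rho> \<noteq> {}" "\<rho> \<in> K \<Longrightarrow> \<rho> \<subseteq> {1..n + k + 2}"
    "\<rho> \<in> K \<Longrightarrow> \<phi> \<subseteq> \<rho> \<Longrightarrow> \<phi> \<noteq> {} \<Longrightarrow> \<phi> \<in> K" "\<rho> \<in> K \<Longrightarrow> finite \<rho>"
proof -
  have "finite K \<and> (\<forall>\<rho>\<in>K. \<rho> \<noteq> {} \<and> \<rho> \<subseteq> {1..n + k + 2} \<and> (\<forall>\<phi>\<subseteq>\<rho>. \<phi> \<noteq> {} \<longrightarrow> \<phi> \<in> K))"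
    using assms
  proof induction
    case initial
    then show ?case by (auto simp: full_simplex_def)
  next
    case (step n K \<sigma>)
    have s: "\<sigma> \<in> K" using step by (auto simp: simplices_def)
    then have "finite \<sigma>" using step finite_subset by (metis finite_atLeastAtMost)
    then have "finite (full_simplex (insert (n+1+k+2) \<sigma>))" by (auto simp: full_simplex_def)
    then have "finite (attach (n+1+k+2) K \<sigma>)" using step by (simp add: attach_def)
    moreover have "\<rho> \<noteq> {} \<and> \<rho> \<subseteq> {1..Suc n + k + 2} \<and>
        (\<forall>\<phi>\<subseteq>\<rho>. \<phi> \<noteq> {} \<longrightarrow> \<phi> \<in> attach (n+1+k+2) K \<sigma>)"
      if r: "\<rho> \<in> attach (n+1+k+2) K \<sigma>" for \<rho>
    proof (cases "\<rho> \<in> K")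
      case True
      then have "\<rho> \<subseteq> {1..n + k + 2}" using step by blast
      then have "\<rho> \<subseteq> {1..Suc n + k + 2}" by auto
      then show ?thesis using step.IH True unfolding attach_def by blast
    next
      case False
      then have r: "\<rho> \<subseteq> insert (n+1+k+2) \<sigma>" "\<rho> \<noteq> {}"
        using r by (auto simp: attach_def full_simplex_def)
      have "\<sigma> \<subseteq> {1..n + k + 2}" using step s by blast
      then have "insert (n+1+k+2) \<sigma> \<subseteq> {1..Suc n + k + 2}" by auto
      then show ?thesis using r unfolding attach_def full_simplex_def by blast
    qed
    ultimately show ?case by blast
  qed
  then show "finite K" "\<rho> \<in> K \<Longrightarrow> \<rho> \<noteq> {}" "\<rho> \<in> K \<Longrightarrow> \<rho> \<subseteq> {1..n + k + 2}"
    "\<rho> \<in> K \<Longrightarrow> \<phi> \<subseteq> \<rho> \<Longrightarrow> \<phi> \<noteq> {} \<Longrightarrow> \<phi> \<in> K"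
    by blast+
  then show "\<rho> \<in> K \<Longrightarrow> finite \<rho>"
    by (meson finite_atLeastAtMost finite_subset)
qed

lemma new_vertex_notin:
  assumes "reachable k n K" "\<rho> \<in> K"
  shows "n + 1 + k + 2 \<notin> \<rho>"
  using reachable_complex(3)[OF assms] by auto

text \<open>Faces of \<open>insert v \<sigma>\<close> that avoid \<open>v\<close> are faces of
  \<sigma> and already present, so a new coface of \<open>f\<close> contains
  \<open>v\<close>.\<close>

lemma cofaces_attach:
  assumes K: "reachable k n K" and \<sigma>: "\<sigma> \<in> simplices k K" and v: "v = n + 1 + k + 2"
  shows "cofaces j (attach v K \<sigma>) f
      = cofaces j K f \<union> {\<rho>. insert v f \<subseteq> \<rho> \<and> \<rho> \<subseteq> insert v \<sigma> \<and> card \<rho> = j}"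
    and "cofaces j K f \<inter> {\<rho>. insert v f \<subseteq> \<rho> \<and> \<rho> \<subseteq> insert v \<sigma> \<and> card \<rho> = j} = {}"
    and "card (cofaces j (attach v K \<sigma>) f)
      = card (cofaces j K f) + card {\<rho>. insert v f \<subseteq> \<rho> \<and> \<rho> \<subseteq> insert v \<sigma> \<and> card \<rho> = j}"
proof -
  have s: "\<sigma> \<in> K" using \<sigma> by (simp add: simplices_def)
  have new: "\<rho> \<in> K" if "\<rho> \<subseteq> insert v \<sigma>" "\<rho> \<noteq> {}" "v \<notin> \<rho>" for \<rho>
    using reachable_complex(4)[OF K s] that by blast
  show eq: "cofaces j (attach v K \<sigma>) f
      = cofaces j K f \<union> {\<rho>. insert v f \<subseteq> \<rho> \<and> \<rho> \<subseteq> insert v \<sigma> \<and> card \<rho> = j}"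
    using new unfolding cofaces_def attach_def full_simplex_def by blast
  show disj: "cofaces j K f \<inter> {\<rho>. insert v f \<subseteq> \<rho> \<and> \<rho> \<subseteq> insert v \<sigma> \<and> card \<rho> = j} = {}"
    using new_vertex_notin[OF K] v by (auto simp: cofaces_def)
  have "finite (cofaces j K f)" using reachable_complex(1)[OF K] by (simp add: cofaces_def)
  moreover have "finite {\<rho>. insert v f \<subseteq> \<rho> \<and> \<rho> \<subseteq> insert v \<sigma> \<and> card \<rho> = j}"
    using reachable_complex(5)[OF K s] by simp
  ultimately show "card (cofaces j (attach v K \<sigma>) f)
      = card (cofaces j K f) + card {\<rho>. insert v f \<subseteq> \<rho> \<and> \<rho> \<subseteq> insert v \<sigma> \<and> card \<rho> = j}"
    unfolding eq using disj by (simp add: card_Un_disjoint)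
qed

text \<open>Counts inside a single (k+1)-simplex. They serve the initial complex and every face
  through the newest vertex, all of whose cofaces lie in the one added simplex.\<close>

lemma coface_counts_full:
  assumes "finite A" "card A = k + 2" "f \<subseteq> A" "card f \<le> k + 1"
  shows "card {\<rho>. f \<subseteq> \<rho> \<and> \<rho> \<subseteq> A \<and> card \<rho> = k + 2} = 1"
    and "card {\<rho>. f \<subseteq> \<rho> \<and> \<rho> \<subseteq> A \<and> card \<rho> = k + 1} = k + 2 - card f"
    and "card {\<rho>. f \<subseteq> \<rho> \<and> \<rho> \<subseteq> A \<and> card \<rho> = card f + 1} = k + 2 - card f"
proof -
  have "(Suc (Suc k) - card f) choose (Suc k - card f) = Suc (Suc k) - card f"
    using binomial_symmetric[of 1 "Suc (Suc k) - card f"] assms(4) by (simp add: Suc_diff_le)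
  then show "card {\<rho>. f \<subseteq> \<rho> \<and> \<rho> \<subseteq> A \<and> card \<rho> = k + 2} = 1"
    "card {\<rho>. f \<subseteq> \<rho> \<and> \<rho> \<subseteq> A \<and> card \<rho> = k + 1} = k + 2 - card f"
    "card {\<rho>. f \<subseteq> \<rho> \<and> \<rho> \<subseteq> A \<and> card \<rho> = card f + 1} = k + 2 - card f"
    using assms by (simp_all add: card_sets_between)
qed

text \<open>The case \<open>f = {}\<close> yields the global counts.\<close>

lemma coface_counts:
  assumes "reachable k n K" "f = {} \<or> f \<in> K" "card f \<le> k + 1"
  shows "card (cofaces (k + 1) K f) = 1 + (k + 1 - card f) * card (cofaces (k + 2) K f)"
    and "card (cofaces (card f + 1) K f) = card (cofaces (k + 2) K f) + (k + 1 - card f)"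
    and "card (cofaces (k + 2) K f) \<ge> 1"
    and "f = {} \<Longrightarrow> card (cofaces (k + 2) K f) = n + 1"
proof -
  have "card (cofaces (k + 1) K f) = 1 + (k + 1 - card f) * card (cofaces (k + 2) K f) \<and>
      card (cofaces (card f + 1) K f) = card (cofaces (k + 2) K f) + (k + 1 - card f) \<and>
      card (cofaces (k + 2) K f) \<ge> 1 \<and>
      (f = {} \<longrightarrow> card (cofaces (k + 2) K f) = n + 1)"
    using assms
  proof (induction arbitrary: f)
    case initial
    have eq: "cofaces j (full_simplex {1..k + 2}) f
        = {\<rho>. f \<subseteq> \<rho> \<and> \<rho> \<subseteq> {1..k + 2} \<and> card \<rho> = j}" if "j > 0" for j
      using that by (auto simp: cofaces_def full_simplex_def)
    have "f \<subseteq> {1..k + 2}" using initial by (auto simp: full_simplex_def)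
    note c = coface_counts_full[OF _ _ this initial(2)]
    have "card (cofaces (k + 2) (full_simplex {1..k + 2}) f) = 1"
      by (subst eq) (simp, rule c(1), simp_all)
    moreover have "card (cofaces (k + 1) (full_simplex {1..k + 2}) f) = k + 2 - card f"
      by (subst eq) (simp, rule c(2), simp_all)
    moreover have "card (cofaces (card f + 1) (full_simplex {1..k + 2}) f) = k + 2 - card f"
      by (subst eq) (simp, rule c(3), simp_all)
    moreover have "k + 2 - card f = 1 + (k + 1 - card f)" using initial(2) by simp
    ultimately show ?case by (cases "f = {}") simp_all
  next
    case (step n K \<sigma>)
    define v where "v = n + 1 + k + 2"
    define new where "new j = {\<rho>. insert v f \<subseteq> \<rho> \<and> \<rho> \<subseteq> insert v \<sigma> \<and> card \<rho> = j}" for j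
    have ca: "card (cofaces j (attach v K \<sigma>) f) = card (cofaces j K f) + card (new j)" for j
      unfolding new_def by (rule cofaces_attach(3)[OF step(1,2) v_def])
    have s: "\<sigma> \<in> K" "card \<sigma> = k + 1" using step by (auto simp: simplices_def)
    have fins: "finite \<sigma>" using reachable_complex(5)[OF step(1) s(1)] .
    have vs: "v \<notin> \<sigma>" using new_vertex_notin[OF step(1) s(1)] by (simp add: v_def)
    have A: "finite (insert v \<sigma>)" "card (insert v \<sigma>) = k + 2" using fins vs s by auto
    show ?case
    proof (cases "v \<in> f")
      case True
      then have "cofaces j K f = {}" for j
        using new_vertex_notin[OF step(1)] by (auto simp: cofaces_def v_def)
      moreover have "f \<subseteq> insert v \<sigma>"
        using step(4) True new_vertex_notin[OF step(1)]
        unfolding attach_def full_simplex_def v_def[symmetric] by blast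
      note coface_counts_full[OF A this step(5)]
      moreover have "insert v f = f" using True by auto
      moreover have "k + 2 - card f = 1 + (k + 1 - card f)" using step(5) by simp
      moreover have "f \<noteq> {}" using True by auto
      ultimately show ?thesis unfolding v_def[symmetric] ca new_def by simp
    next
      case False
      have f: "f = {} \<or> f \<in> K"
        using step(4) False reachable_complex(4)[OF step(1) s(1)]
        unfolding attach_def full_simplex_def v_def[symmetric] by blast
      note IH = step.IH[OF f step(5)]
      have finf: "finite f" using f reachable_complex(5)[OF step(1)] by blast
      show ?thesis
      \<comment> \<open>A choice around \<open>f\<close> adds one (k+1)-simplex, one coface with one
        more element, namely \<open>insert v f\<close>, and k + 1 - card f cofaces of dimension k.
        The relations are preserved by these increments.\<close>
      proof (cases "f \<subseteq> \<sigma>")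
        case fs: True
        then have sub: "insert v f \<subseteq> insert v \<sigma>" by auto
        have cv: "card (insert v f) = card f + 1" using False finf by simp
        have n1: "card (new (k + 2)) = 1"
          unfolding new_def using card_sets_between[OF A(1) sub] A cv step(5) by simp
        have n2: "card (new (card f + 1)) = 1"
          unfolding new_def using card_sets_between[OF A(1) sub] A cv step(5) by simp
        have n3: "card (new (k + 1)) = k + 1 - card f"
        proof (cases "card f = k + 1")
          \<comment> \<open>Now \<open>insert v f\<close> has k + 2 elements and fits into no new
            k-simplex, so the binomial count does not apply.\<close>
          case True
          have "\<not> insert v f \<subseteq> \<rho>" if "card \<rho> = k + 1" "\<rho> \<subseteq> insert v \<sigma>" for \<rho>
          proof
            assume "insert v f \<subseteq> \<rho>"
            then have "card (insert v f) \<le> card \<rho>"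
              using that A(1) by (intro card_mono) (auto intro: finite_subset)
            then show False using cv True that by simp
          qed
          then have "new (k + 1) = {}" unfolding new_def by auto
          then show ?thesis using True by simp
        next
          case False
          then have "card f \<le> k" using step(5) by simp
          then have "(Suc k - card f) choose (k - card f) = Suc k - card f"
            using binomial_symmetric[of 1 "Suc k - card f"] by (simp add: Suc_diff_le)
          then show ?thesis
            unfolding new_def using card_sets_between[OF A(1) sub] A cv \<open>card f \<le> k\<close> by simp
        qed
        show ?thesis
          using IH n1 n2 n3 unfolding v_def[symmetric] ca by (simp add: algebra_simps)
      next
        case fs: False
        then have "new j = {}" for j using False by (auto simp: new_def)
        moreover have "f \<noteq> {}" using fs by auto
        ultimately show ?thesis using IH unfolding v_def[symmetric] ca by simp
      qed
    qed
  qed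
  then show "card (cofaces (k + 1) K f) = 1 + (k + 1 - card f) * card (cofaces (k + 2) K f)"
    and "card (cofaces (card f + 1) K f) = card (cofaces (k + 2) K f) + (k + 1 - card f)"
    and "card (cofaces (k + 2) K f) \<ge> 1"
    and "f = {} \<Longrightarrow> card (cofaces (k + 2) K f) = n + 1"
    by blast+
qed

text \<open>Double counting of pairs \<sigma> \<subseteq> \<rho> above \<open>f\<close>: each coface
  \<rho> with k + 2 elements contains k + 2 - card f of the \<sigma>. The number of \<sigma>, needed
  for the \<delta> part, is affine in \<open>x\<close> by \<open>coface_counts\<close>.\<close>

lemma sum_weight_cofaces:
  assumes K: "reachable k n K" and f: "f = {} \<or> f \<in> K" "card f \<le> k + 1"
  defines "x \<equiv> card (cofaces (k + 2) K f)"
  shows "(\<Sum>\<sigma>\<in>cofaces (k + 1) K f. real (face_degree k K \<sigma>) + \<delta>)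
    = real x * (real k + 2 - card f) + \<delta> * (1 + (real k + 1 - card f) * real x)"
proof -
  have fin: "finite (cofaces j K g)" for j g
    using reachable_complex(1)[OF K] by (simp add: cofaces_def)
  have "(\<Sum>\<sigma>\<in>cofaces (k + 1) K f. card (cofaces (k + 2) K \<sigma>))
      = (\<Sum>\<sigma>\<in>cofaces (k + 1) K f. card {\<rho>\<in>cofaces (k + 2) K f. \<sigma> \<subseteq> \<rho>})"
    by (intro sum.cong arg_cong[where f = card]) (auto simp: cofaces_def)
  also have "\<dots> = (k + 2 - card f) * card (cofaces (k + 2) K f)"
  proof (rule sum_multicount[OF fin fin], safe)
    fix \<rho> assume r: "\<rho> \<in> cofaces (k + 2) K f"
    moreover have "\<sigma> \<noteq> {}" if "card \<sigma> = k + 1" for \<sigma> :: "nat set" using that by auto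
    ultimately have "{\<sigma> \<in> cofaces (k + 1) K f. \<sigma> \<subseteq> \<rho>} = {\<sigma>. f \<subseteq> \<sigma> \<and> \<sigma> \<subseteq> \<rho> \<and> card \<sigma> = k + 1}"
      using reachable_complex(4)[OF K, of \<rho>] by (auto simp: cofaces_def)
    then show "card {\<sigma> \<in> cofaces (k + 1) K f. \<sigma> \<subseteq> \<rho>} = k + 2 - card f"
      using coface_counts_full(2)[of \<rho> k f] r f(2) reachable_complex(5)[OF K]
      by (simp add: cofaces_def)
  qed
  finally have "(\<Sum>\<sigma>\<in>cofaces (k + 1) K f. real (face_degree k K \<sigma>))
      = real ((k + 2 - card f) * x)"
    by (simp add: face_degree_eq_cofaces x_def flip: of_nat_sum)
  also have "\<dots> = real x * (real k + 2 - card f)" using f(2) by (simp add: of_nat_diff)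
  finally have "(\<Sum>\<sigma>\<in>cofaces (k + 1) K f. real (face_degree k K \<sigma>))
      = real x * (real k + 2 - card f)" .
  moreover have "real (card (cofaces (k + 1) K f)) = 1 + (real k + 1 - card f) * real x"
    using coface_counts(1)[OF K f] f(2) by (simp add: x_def of_nat_diff)
  ultimately show ?thesis
    by (simp add: sum.distrib mult.commute)
qed

text \<open>The empty face, for which \<open>x\<close> is n + 1. One step raises degrees by k + 2 in
  total and adds k + 1 simplices of dimension k, so \<open>tau\<close> is the weight gained per
  step; it is the formula of \<open>b_coeff\<close> continued to m = -1.\<close>

lemma sum_weight_simplices:
  assumes "reachable k n K"
  shows "(\<Sum>\<sigma>\<in>simplices k K. real (face_degree k K \<sigma>) + \<delta>) = (real n + 1) * tau k \<delta> + \<delta>"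
proof -
  have "(\<Sum>\<sigma>\<in>simplices k K. real (face_degree k K \<sigma>) + \<delta>)
      = real (n + 1) * (real k + 2 - 0) + \<delta> * (1 + (real k + 1 - 0) * real (n + 1))"
    using sum_weight_cofaces[OF assms, of "{}" \<delta>] coface_counts(4)[OF assms, of "{}"]
    unfolding simplices_eq_cofaces by simp
  then show ?thesis by (simp add: tau_def algebra_simps)
qed

lemma face_degree_eq:
  assumes K: "reachable k n K" and f: "f \<in> K" "card f = m + 1" "m \<le> k"
  shows "face_degree m K f = card (cofaces (k + 2) K f) + (k - m)"
  using coface_counts(2)[OF K, of f] f by (simp add: face_degree_eq_cofaces)

text \<open>The m-degree minus k - m is the number of (k+1)-simplices around \<open>f\<close>. Each
  further one brings k - m + 1 units of degree and k - m new k-simplices, which is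
  \<open>b_coeff\<close>; the single \<delta> stems from the constant 1 in the number of
  k-simplices.\<close>

lemma sum_weight_face:
  assumes K: "reachable k n K" and f: "f \<in> K" "card f = m + 1" "m \<le> k"
  shows "(\<Sum>\<sigma> | \<sigma> \<in> simplices k K \<and> f \<subseteq> \<sigma>. real (face_degree k K \<sigma>) + \<delta>)
    = (real (face_degree m K f) - real k + real m) * b_coeff k \<delta> m + \<delta>"
proof -
  have "{\<sigma>. \<sigma> \<in> simplices k K \<and> f \<subseteq> \<sigma>} = cofaces (k + 1) K f"
    by (auto simp: simplices_def cofaces_def)
  then have "(\<Sum>\<sigma> | \<sigma> \<in> simplices k K \<and> f \<subseteq> \<sigma>. real (face_degree k K \<sigma>) + \<delta>)
      = real (card (cofaces (k + 2) K f)) * (real k + 2 - card f)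
        + \<delta> * (1 + (real k + 1 - card f) * real (card (cofaces (k + 2) K f)))"
    using sum_weight_cofaces[OF K, of f \<delta>] f by simp
  then show ?thesis
    using face_degree_eq[OF assms] f by (simp add: b_coeff_def algebra_simps of_nat_diff)
qed

text \<open>Every k-simplex of a reachable complex lies in a (k+1)-simplex, so its degree is at
  least 1, which compensates a negative \<delta>.\<close>

lemma weight_pos:
  assumes K: "reachable k n K" and \<sigma>: "\<sigma> \<in> simplices k K" and "\<delta> > -1"
  shows "real (face_degree k K \<sigma>) + \<delta> > 0"
  using coface_counts(3)[OF K, of \<sigma>] \<sigma> assms(3)
  by (auto simp: face_degree_eq_cofaces simplices_def)

section \<open>Degree vectors and one attachment step\<close>

definition top_face :: "nat \<Rightarrow> nat \<Rightarrow> nat set \<Rightarrow> nat set" where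
  "top_face k m \<rho> = set (drop (k - m) (sorted_list_of_set \<rho>))"

text \<open>Two facts carry the later arguments: these faces increase with \<open>m\<close>, and
  each contains the largest vertex.\<close>

lemma top_face:
  assumes "finite \<rho>" "card \<rho> = k + 1" "m \<le> k"
  shows "top_face k m \<rho> \<subseteq> \<rho>" "card (top_face k m \<rho>) = m + 1" "top_face k m \<rho> \<noteq> {}"
    "m \<le> m' \<Longrightarrow> top_face k m \<rho> \<subseteq> top_face k m' \<rho>"
    "u \<in> \<rho> \<Longrightarrow> (\<And>x. x \<in> \<rho> \<Longrightarrow> x \<le> u) \<Longrightarrow> u \<in> top_face k m \<rho>"
proof -
  define xs where "xs = sorted_list_of_set \<rho>"
  have xs: "set xs = \<rho>" "length xs = k + 1" "sorted xs" "distinct xs"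
    using assms by (simp_all add: xs_def)
  show "top_face k m \<rho> \<subseteq> \<rho>"
    using xs(1) set_drop_subset[of "k - m" xs] by (simp add: top_face_def xs_def)
  show c: "card (top_face k m \<rho>) = m + 1"
    using xs assms(3) by (simp add: top_face_def xs_def[symmetric] distinct_card)
  show "top_face k m \<rho> \<noteq> {}" using c by auto
  show "top_face k m \<rho> \<subseteq> top_face k m' \<rho>" if "m \<le> m'"
    unfolding top_face_def using that by (intro set_drop_subset_set_drop) simp
  show "u \<in> top_face k m \<rho>" if u: "u \<in> \<rho>" "\<And>x. x \<in> \<rho> \<Longrightarrow> x \<le> u"
  proof -
    have ne: "drop (k - m) xs \<noteq> []" "xs \<noteq> []" using xs assms(3) by auto
    have l: "last (drop (k - m) xs) = last xs" using xs ne by (simp add: last_drop)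
    have "u \<le> last xs"
      using u(1) xs ne by (metis in_set_conv_nth last_conv_nth Suc_pred' diff_less length_greater_0_conv
        less_Suc_eq_le sorted_nth_mono zero_less_one)
    moreover have "last xs \<le> u" using u(2) xs(1) ne(2) last_in_set by metis
    ultimately have "u = last (drop (k - m) xs)" using l by simp
    then show ?thesis using ne last_in_set unfolding top_face_def xs_def by metis
  qed
qed

definition degree_vector :: "nat \<Rightarrow> nat set set \<Rightarrow> nat set \<Rightarrow> nat list" where
  "degree_vector k K \<rho> = map (\<lambda>m. face_degree m K (top_face k m \<rho>)) [0..<k + 1]"

lemma degree_vector_nth: "m \<le> k \<Longrightarrow> degree_vector k K \<rho> ! m = face_degree m K (top_face k m \<rho>)"
  by (simp add: degree_vector_def del: upt_Suc)

lemma length_degree_vector [simp]: "length (degree_vector k K \<rho>) = k + 1"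
  by (simp add: degree_vector_def)

lemma degree_vector_eq_iff:
  assumes "length is = k + 1"
  shows "degree_vector k K \<rho> = is \<longleftrightarrow> (\<forall>m\<le>k. face_degree m K (top_face k m \<rho>) = is ! m)"
  using assms by (auto simp: list_eq_iff_nth_eq degree_vector_nth less_Suc_eq_le)

lemma degree_count_eq:
  assumes "length is = k + 1"
  shows "degree_count k K is = card {\<rho> \<in> simplices k K. degree_vector k K \<rho> = is}"
  using assms by (simp add: degree_count_def degree_vector_eq_iff top_face_def)

lemma top_face_simplex:
  assumes "reachable k n K" "\<rho> \<in> simplices k K" "m \<le> k"
  shows "top_face k m \<rho> \<in> K" "card (top_face k m \<rho>) = m + 1"
  using assms top_face[of \<rho> k m] reachable_complex(4,5)[OF assms(1)]
  unfolding simplices_def by blast+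

text \<open>The number of (k+1)-simplices around a face decreases weakly as the face grows; the
  offset k - m in \<open>face_degree_eq\<close> turns this into strict decrease.\<close>

lemma degree_vector_in_degree_indices:
  assumes K: "reachable k n K" and \<rho>: "\<rho> \<in> simplices k K"
  shows "degree_vector k K \<rho> \<in> degree_indices k"
proof -
  have fin: "finite \<rho>" "card \<rho> = k + 1"
    using \<rho> reachable_complex(5)[OF K] by (auto simp: simplices_def)
  have d: "degree_vector k K \<rho> ! m = card (cofaces (k + 2) K (top_face k m \<rho>)) + (k - m)"
    if "m \<le> k" for m
    using face_degree_eq[OF K top_face_simplex[OF K \<rho> that] that] that
    by (simp add: degree_vector_nth)
  have "degree_vector k K \<rho> ! j < degree_vector k K \<rho> ! i" if ij: "i < j" "j \<le> k" for i j
  proof -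
    have "cofaces (k + 2) K (top_face k j \<rho>) \<subseteq> cofaces (k + 2) K (top_face k i \<rho>)"
      using top_face(4)[OF fin, of i j] ij by (auto simp: cofaces_def)
    then have "card (cofaces (k + 2) K (top_face k j \<rho>)) \<le> card (cofaces (k + 2) K (top_face k i \<rho>))"
      using reachable_complex(1)[OF K] by (intro card_mono) (auto simp: cofaces_def)
    then show ?thesis using ij by (simp add: d)
  qed
  moreover have "degree_vector k K \<rho> ! k \<ge> 1"
    using d[of k] coface_counts(3)[OF K, of "top_face k k \<rho>"] top_face_simplex[OF K \<rho>, of k] by simp
  ultimately show ?thesis
    by (simp add: degree_indices_def sorted_wrt_iff_nth_less less_Suc_eq_le)
qed

text \<open>The only possible new coface of \<open>f\<close> with m + 2 elements is
  \<open>insert v f\<close>.\<close>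

lemma face_degree_attach_old:
  assumes K: "reachable k n K" and \<sigma>: "\<sigma> \<in> simplices k K" and v: "v = n + 1 + k + 2"
    and f: "f \<in> K" "card f = m + 1" "m \<le> k"
  shows "face_degree m (attach v K \<sigma>) f = face_degree m K f + of_bool (f \<subseteq> \<sigma>)"
proof -
  have s: "\<sigma> \<in> K" "finite \<sigma>" "card \<sigma> = k + 1" "v \<notin> \<sigma>"
    using \<sigma> reachable_complex(5)[OF K] new_vertex_notin[OF K] v by (auto simp: simplices_def)
  have vf: "v \<notin> f" "finite f" using f new_vertex_notin[OF K] reachable_complex(5)[OF K] v by auto
  have "card {\<rho>. insert v f \<subseteq> \<rho> \<and> \<rho> \<subseteq> insert v \<sigma> \<and> card \<rho> = m + 2} = of_bool (f \<subseteq> \<sigma>)"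
  proof (cases "f \<subseteq> \<sigma>")
    case True
    then show ?thesis
      using card_sets_between[of "insert v \<sigma>" "insert v f" "m + 2"] s vf f by auto
  next
    case False
    then have "{\<rho>. insert v f \<subseteq> \<rho> \<and> \<rho> \<subseteq> insert v \<sigma> \<and> card \<rho> = m + 2} = {}"
      using vf by auto
    then show ?thesis using False by (simp only: card.empty of_bool_def if_False)
  qed
  then show ?thesis using cofaces_attach(3)[OF K \<sigma> v] by (simp add: face_degree_eq_cofaces)
qed

text \<open>All cofaces lie in \<open>insert v \<sigma>\<close> and arise by adding one of its k + 2
  - (m + 1) remaining vertices.\<close>

lemma face_degree_attach_new:
  assumes K: "reachable k n K" and \<sigma>: "\<sigma> \<in> simplices k K" and v: "v = n + 1 + k + 2"
    and f: "v \<in> f" "f \<subseteq> insert v \<sigma>" "card f = m + 1" "m \<le> k"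
  shows "face_degree m (attach v K \<sigma>) f = k - m + 1"
proof -
  have s: "\<sigma> \<in> K" "finite \<sigma>" "card \<sigma> = k + 1" "v \<notin> \<sigma>"
    using \<sigma> reachable_complex(5)[OF K] new_vertex_notin[OF K] v by (auto simp: simplices_def)
  have "cofaces (m + 2) K f = {}" using new_vertex_notin[OF K] f v by (auto simp: cofaces_def)
  moreover have "card {\<rho>. insert v f \<subseteq> \<rho> \<and> \<rho> \<subseteq> insert v \<sigma> \<and> card \<rho> = m + 2} = k - m + 1"
    using coface_counts_full(3)[of "insert v \<sigma>" k f] s f by (simp add: insert_absorb)
  ultimately show ?thesis
    using cofaces_attach(3)[OF K \<sigma> v, of "m + 2" f] by (simp add: face_degree_eq_cofaces)
qed

text \<open>The degree vector with which every k-simplex through the newest vertex is born; it gives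
  the source term of the recursion.\<close>

definition root_index :: "nat \<Rightarrow> nat list \<Rightarrow> bool" where
  "root_index k is \<longleftrightarrow> (\<forall>l\<le>k. is ! l = k - l + 1)"

text \<open>The new vertex exceeds all others, so it lies in every top face of a new simplex, and
  \<open>face_degree_attach_new\<close> determines the whole vector regardless of \<sigma>.\<close>

lemma simplices_attach:
  assumes K: "reachable k n K" and \<sigma>: "\<sigma> \<in> simplices k K" and v: "v = n + 1 + k + 2"
  defines "new \<equiv> {\<rho>. {v} \<subseteq> \<rho> \<and> \<rho> \<subseteq> insert v \<sigma> \<and> card \<rho> = k + 1}"
  shows "simplices k (attach v K \<sigma>) = simplices k K \<union> new" "simplices k K \<inter> new = {}"
    "finite new" "card new = k + 1"
    "\<rho> \<in> new \<Longrightarrow> m \<le> k \<Longrightarrow> face_degree m (attach v K \<sigma>) (top_face k m \<rho>) = k - m + 1"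
proof -
  have s: "\<sigma> \<in> K" "finite \<sigma>" "card \<sigma> = k + 1" "v \<notin> \<sigma>"
    using \<sigma> reachable_complex(5)[OF K] new_vertex_notin[OF K] v by (auto simp: simplices_def)
  show "simplices k (attach v K \<sigma>) = simplices k K \<union> new" "simplices k K \<inter> new = {}"
    using cofaces_attach(1,2)[OF K \<sigma> v, of "k + 1" "{}"] by (simp_all add: simplices_eq_cofaces new_def)
  show "finite new" using s unfolding new_def by simp
  show "card new = k + 1"
    using coface_counts_full(2)[of "insert v \<sigma>" k "{v}"] s unfolding new_def by simp
  show "face_degree m (attach v K \<sigma>) (top_face k m \<rho>) = k - m + 1" if r: "\<rho> \<in> new" "m \<le> k"
  proof -
    have r': "v \<in> \<rho>" "\<rho> \<subseteq> insert v \<sigma>" "card \<rho> = k + 1" "finite \<rho>"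
      using r s unfolding new_def by (auto intro: finite_subset)
    have "x \<le> v" if "x \<in> \<rho>" for x
      using that r'(2) reachable_complex(3)[OF K s(1)] v by auto
    then have "v \<in> top_face k m \<rho>" using top_face(5)[OF r'(4,3) r(2), of v] r'(1) by blast
    moreover have "top_face k m \<rho> \<subseteq> insert v \<sigma>" using top_face(1)[OF r'(4,3) r(2)] r'(2) by blast
    ultimately show ?thesis
      using face_degree_attach_new[OF K \<sigma> v] top_face(2)[OF r'(4,3) r(2)] r(2) by blast
  qed
qed

section \<open>How one choice changes degree vectors and counts\<close>

definition overlap :: "nat \<Rightarrow> nat set \<Rightarrow> nat set \<Rightarrow> nat" where
  "overlap k \<rho> \<sigma> = card {m. m \<le> k \<and> top_face k m \<rho> \<subseteq> \<sigma>}"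

text \<open>As top faces are nested, those inside \<sigma> form an initial segment; a single number
  records which entries of the vector are raised.\<close>

lemma overlap:
  assumes "finite \<rho>" "card \<rho> = k + 1"
  shows "overlap k \<rho> \<sigma> \<le> k + 1" "m \<le> k \<Longrightarrow> top_face k m \<rho> \<subseteq> \<sigma> \<longleftrightarrow> m < overlap k \<rho> \<sigma>"
proof -
  define S where "S = {m. m \<le> k \<and> top_face k m \<rho> \<subseteq> \<sigma>}"
  have S: "S \<subseteq> {..k}" "finite S" by (auto simp: S_def)
  then have "card S \<le> card {..k}" by (intro card_mono) auto
  then show "overlap k \<rho> \<sigma> \<le> k + 1" by (simp add: overlap_def S_def)
  have down: "m' \<in> S" if "m \<in> S" "m' \<le> m" for m m'
    using that top_face(4)[OF assms, of m' m] by (auto simp: S_def)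
  show "top_face k m \<rho> \<subseteq> \<sigma> \<longleftrightarrow> m < overlap k \<rho> \<sigma>" if m: "m \<le> k"
  proof
    assume "top_face k m \<rho> \<subseteq> \<sigma>"
    then have "{..m} \<subseteq> S" using m down[of m] by (auto simp: S_def)
    then have "card {..m} \<le> card S" using S by (intro card_mono) auto
    then show "m < overlap k \<rho> \<sigma>" by (simp add: overlap_def S_def)
  next
    assume lt: "m < overlap k \<rho> \<sigma>"
    show "top_face k m \<rho> \<subseteq> \<sigma>"
    proof (rule ccontr)
      assume "\<not> top_face k m \<rho> \<subseteq> \<sigma>"
      then have "m \<notin> S" by (simp add: S_def)
      then have "S \<subseteq> {..<m}" using down by (meson lessThan_iff not_le subsetI)
      then have "card S \<le> card {..<m}" by (intro card_mono) auto
      then show False using lt by (simp add: overlap_def S_def)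
    qed
  qed
qed

lemma length_lower [simp]: "length (lower J is) = length is"
  by (simp add: lower_def)

lemma lower_nth: "i < length is \<Longrightarrow> lower J is ! i = (if i < J then is ! i - 1 else is ! i)"
  by (auto simp: lower_def nth_append min_def)

text \<open>The choice adds one to the first \<open>overlap k \<rho> \<sigma>\<close> entries. The
  entries of \<open>is\<close> are positive, so the truncated subtraction in \<open>lower\<close>
  undoes this exactly.\<close>

lemma degree_vector_attach:
  assumes K: "reachable k n K" and \<sigma>: "\<sigma> \<in> simplices k K" and v: "v = n + 1 + k + 2"
    and \<rho>: "\<rho> \<in> simplices k K" and I: "is \<in> degree_indices k"
  shows "degree_vector k (attach v K \<sigma>) \<rho> = is \<longleftrightarrow>
    degree_vector k K \<rho> = lower (overlap k \<rho> \<sigma>) is"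
proof -
  have fin: "finite \<rho>" "card \<rho> = k + 1"
    using \<rho> reachable_complex(5)[OF K] by (auto simp: simplices_def)
  have len: "length is = k + 1" using I by (simp add: degree_indices_def)
  have "is ! m \<ge> 1" if "m \<le> k" for m using sorted_gt_nth_lower_bound[OF I that] by simp
  moreover have "face_degree m (attach v K \<sigma>) (top_face k m \<rho>)
      = face_degree m K (top_face k m \<rho>) + of_bool (m < overlap k \<rho> \<sigma>)" if "m \<le> k" for m
    using face_degree_attach_old[OF K \<sigma> v top_face_simplex[OF K \<rho> that] that] overlap(2)[OF fin that]
    by simp
  ultimately have "face_degree m (attach v K \<sigma>) (top_face k m \<rho>) = is ! m \<longleftrightarrow>
      face_degree m K (top_face k m \<rho>) = lower (overlap k \<rho> \<sigma>) is ! m" if "m \<le> k" for m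
    using that len by (force simp: lower_nth)
  then show ?thesis using len by (simp add: degree_vector_eq_iff)
qed

lemma degree_count_attach:
  assumes K: "reachable k n K" and \<sigma>: "\<sigma> \<in> simplices k K" and v: "v = n + 1 + k + 2"
    and I: "is \<in> degree_indices k"
  shows "degree_count k (attach v K \<sigma>) is =
    card {\<rho> \<in> simplices k K. degree_vector k K \<rho> = lower (overlap k \<rho> \<sigma>) is}
    + (k + 1) * of_bool (root_index k is)"
proof -
  have len: "length is = k + 1" using I by (simp add: degree_indices_def)
  define new where "new = {\<rho>. {v} \<subseteq> \<rho> \<and> \<rho> \<subseteq> insert v \<sigma> \<and> card \<rho> = k + 1}"
  note n = simplices_attach[OF K \<sigma> v, folded new_def]
  have fin: "finite (simplices k K)" using reachable_complex(1)[OF K] by (simp add: simplices_def)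
  have "{\<rho> \<in> simplices k (attach v K \<sigma>). degree_vector k (attach v K \<sigma>) \<rho> = is}
      = {\<rho> \<in> simplices k K. degree_vector k (attach v K \<sigma>) \<rho> = is}
        \<union> {\<rho> \<in> new. degree_vector k (attach v K \<sigma>) \<rho> = is}"
    unfolding n(1) by blast
  also have "{\<rho> \<in> new. degree_vector k (attach v K \<sigma>) \<rho> = is} = {\<rho> \<in> new. root_index k is}"
    using n(5) len by (auto simp: degree_vector_eq_iff root_index_def)
  also have "{\<rho> \<in> simplices k K. degree_vector k (attach v K \<sigma>) \<rho> = is}
      = {\<rho> \<in> simplices k K. degree_vector k K \<rho> = lower (overlap k \<rho> \<sigma>) is}"
    using degree_vector_attach[OF K \<sigma> v _ I] by blast
  finally have eq: "{\<rho> \<in> simplices k (attach v K \<sigma>). degree_vector k (attach v K \<sigma>) \<rho> = is}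
      = {\<rho> \<in> simplices k K. degree_vector k K \<rho> = lower (overlap k \<rho> \<sigma>) is}
        \<union> {\<rho> \<in> new. root_index k is}" .
  show ?thesis
    unfolding degree_count_eq[OF len] eq using fin n(2,3,4)
    by (subst card_Un_disjoint) auto
qed

text \<open>\<open>U J\<close> is the weight of all \<sigma> with overlap at least \<open>J\<close>;
  for positive \<open>J\<close> these contain the top face of index J - 1. Every overlap is at least
  0 and none reaches k + 2, whence the boundary values. The difference isolates overlap exactly
  \<open>J\<close>.\<close>

lemma sum_weight_overlap:
  fixes \<delta> :: real
  assumes K: "reachable k n K" and \<rho>: "\<rho> \<in> simplices k K"
  defines "U J \<equiv> (if J = 0 then (real n + 1) * tau k \<delta> + \<delta> else if J \<le> k + 1 then
      (real (degree_vector k K \<rho> ! (J - 1)) - real k + real (J - 1)) * b_coeff k \<delta> (J - 1) + \<delta> else 0)"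
  assumes J: "J \<le> k + 1"
  shows "(\<Sum>\<sigma> | \<sigma> \<in> simplices k K \<and> overlap k \<rho> \<sigma> = J. real (face_degree k K \<sigma>) + \<delta>) = U J - U (J + 1)"
proof -
  have fin: "finite \<rho>" "card \<rho> = k + 1"
    using \<rho> reachable_complex(5)[OF K] by (auto simp: simplices_def)
  have finK: "finite (simplices k K)" using reachable_complex(1)[OF K] by (simp add: simplices_def)
  have U: "(\<Sum>\<sigma> | \<sigma> \<in> simplices k K \<and> J \<le> overlap k \<rho> \<sigma>. real (face_degree k K \<sigma>) + \<delta>) = U J"
    for J
  proof (cases J)
    case 0
    then show ?thesis using sum_weight_simplices[OF K, of \<delta>] by (simp add: U_def)
  next
    case (Suc m)
    show ?thesis
    proof (cases "m \<le> k")
      case True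
      then have "{\<sigma>. \<sigma> \<in> simplices k K \<and> J \<le> overlap k \<rho> \<sigma>}
          = {\<sigma>. \<sigma> \<in> simplices k K \<and> top_face k m \<rho> \<subseteq> \<sigma>}"
        using overlap(2)[OF fin True] Suc by auto
      then show ?thesis
        using sum_weight_face[OF K top_face_simplex[OF K \<rho> True] True, of \<delta>] Suc True
        by (simp add: U_def degree_vector_nth)
    next
      case False
      then have "{\<sigma>. \<sigma> \<in> simplices k K \<and> J \<le> overlap k \<rho> \<sigma>} = {}"
        using overlap(1)[OF fin] Suc by (auto simp: not_le intro: le_less_trans)
      then show ?thesis using Suc False by (simp only: sum.empty U_def) simp
    qed
  qed
  have "{\<sigma>. \<sigma> \<in> simplices k K \<and> J \<le> overlap k \<rho> \<sigma>}
      = {\<sigma>. \<sigma> \<in> simplices k K \<and> overlap k \<rho> \<sigma> = J} \<union> {\<sigma>. \<sigma> \<in> simplices k K \<and> J + 1 \<le> overlap k \<rho> \<sigma>}"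
    by auto
  then have "U J = (\<Sum>\<sigma> | \<sigma> \<in> simplices k K \<and> overlap k \<rho> \<sigma> = J. real (face_degree k K \<sigma>) + \<delta>) + U (J + 1)"
    unfolding U[symmetric] using finK by (simp only:, intro sum.union_disjoint) auto
  then show ?thesis by simp
qed

section \<open>Transition rates and the weighted sum of the next counts\<close>

lemma lower_0 [simp]: "lower 0 is = is"
  by (simp add: lower_def)

text \<open>Weight of the choices that move a simplex from \<open>lower (m + 1) is\<close> to
  \<open>is\<close>: a difference of the weights around two consecutive top faces, in which \<delta>
  cancels. For m = k there is no larger face, so \<delta> survives.\<close>

definition rate :: "nat \<Rightarrow> real \<Rightarrow> nat \<Rightarrow> nat list \<Rightarrow> real" where
  "rate k \<delta> m is = (if m < k then (real (is ! m) - 1 - real k + real m) * b_coeff k \<delta> m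
      - (real (is ! (m + 1)) - real k + real m + 1) * b_coeff k \<delta> (m + 1)
    else real (is ! k) - 1 + \<delta>)"

text \<open>Weight of the choices through the largest vertex of a simplex, which are exactly those
  that change its vector.\<close>

definition exit_rate :: "nat \<Rightarrow> real \<Rightarrow> nat list \<Rightarrow> real" where
  "exit_rate k \<delta> is = (real (is ! 0) - real k) * b_coeff k \<delta> 0 + \<delta>"

text \<open>Pairs of a choice \<sigma> and a simplex \<rho> are sorted by overlap \<open>J\<close>.
  Only \<rho> with vector \<open>lower J is\<close> matter, and by \<open>sum_weight_overlap\<close>
  the choices of overlap \<open>J\<close> have the same weight for all of them.\<close>

lemma sum_weight_degree_count_attach:
  assumes K: "reachable k n K" and I: "is \<in> degree_indices k"
  shows "(\<Sum>\<sigma>\<in>simplices k K. (real (face_degree k K \<sigma>) + \<delta>)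
        * degree_count k (attach (n + 1 + k + 2) K \<sigma>) is)
    = ((real n + 1) * tau k \<delta> + \<delta>) * (degree_count k K is + real (k + 1) * of_bool (root_index k is))
      + (\<Sum>m\<le>k. rate k \<delta> m is * degree_count k K (lower (m + 1) is))
      - exit_rate k \<delta> is * degree_count k K is"
proof -
  define S where "S = simplices k K"
  define w where "w \<sigma> = real (face_degree k K \<sigma>) + \<delta>" for \<sigma>
  define T where "T = (real n + 1) * tau k \<delta> + \<delta>"
  \<comment> \<open>Overlap 0 receives what the exit rate leaves of the total weight; the index
    shift reflects that overlap m + 1 means the faces 0 to m.\<close>
  define c where "c J = (if J = 0 then T - exit_rate k \<delta> is else rate k \<delta> (J - 1) is)" for J
  have len: "length is = k + 1" using I by (simp add: degree_indices_def)
  have fin: "finite S" using reachable_complex(1)[OF K] by (simp add: S_def simplices_def)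
  have fr: "finite \<rho>" "card \<rho> = k + 1" if "\<rho> \<in> S" for \<rho>
    using that reachable_complex(5)[OF K] by (auto simp: simplices_def S_def)
  have N: "real (degree_count k K (lower J is)) = (\<Sum>\<rho>\<in>S. of_bool (degree_vector k K \<rho> = lower J is))" for J
    using fin len by (subst degree_count_eq) (simp_all add: S_def Collect_conj_eq Int_commute)
  have split: "real (card {\<rho> \<in> S. degree_vector k K \<rho> = lower (overlap k \<rho> \<sigma>) is})
      = (\<Sum>J\<le>k+1. \<Sum>\<rho>\<in>S. of_bool (degree_vector k K \<rho> = lower J is) * of_bool (overlap k \<rho> \<sigma> = J))" for \<sigma>
  proof -
    have "real (card {\<rho> \<in> S. degree_vector k K \<rho> = lower (overlap k \<rho> \<sigma>) is})
        = (\<Sum>\<rho>\<in>S. of_bool (degree_vector k K \<rho> = lower (overlap k \<rho> \<sigma>) is))"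
      using fin by (simp add: Collect_conj_eq Int_commute)
    also have "\<dots> = (\<Sum>\<rho>\<in>S. \<Sum>J\<le>k+1. of_bool (degree_vector k K \<rho> = lower J is) * of_bool (overlap k \<rho> \<sigma> = J))"
    proof (rule sum.cong[OF refl])
      fix \<rho> assume "\<rho> \<in> S"
      then have "overlap k \<rho> \<sigma> \<in> {..k + 1}" using overlap(1)[OF fr] by simp
      then show "of_bool (degree_vector k K \<rho> = lower (overlap k \<rho> \<sigma>) is)
          = (\<Sum>J\<le>k+1. of_bool (degree_vector k K \<rho> = lower J is) * (of_bool (overlap k \<rho> \<sigma> = J) :: real))"
        by (subst sum.remove[where x = "overlap k \<rho> \<sigma>"]) (auto intro!: sum.neutral)
    qed
    finally show ?thesis by (subst sum.swap)
  qed
  have cU: "(\<Sum>\<sigma>\<in>S. w \<sigma> * of_bool (overlap k \<rho> \<sigma> = J)) = c J"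
    if r: "\<rho> \<in> S" and dv: "degree_vector k K \<rho> = lower J is" and J: "J \<le> k + 1" for \<rho> J
  proof -
    have pos: "is ! m \<ge> 1" if "m \<le> k" for m
      using sorted_gt_nth_lower_bound[OF I that] by simp
    have "(\<Sum>\<sigma>\<in>S. w \<sigma> * of_bool (overlap k \<rho> \<sigma> = J))
        = (\<Sum>\<sigma> | \<sigma> \<in> S \<and> overlap k \<rho> \<sigma> = J. w \<sigma>)"
      using fin by (simp add: sum.inter_filter of_bool_def if_distrib cong: if_cong)
    also have "\<dots> = c J"
      unfolding w_def S_def
      using sum_weight_overlap[OF K r[unfolded S_def] J, of \<delta>] dv J pos[of "J - 1"] len
      by (cases J) (auto simp: c_def T_def exit_rate_def rate_def lower_nth of_nat_diff b_coeff_def)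
    finally show ?thesis .
  qed
  have "(\<Sum>\<sigma>\<in>S. w \<sigma> * real (card {\<rho> \<in> S. degree_vector k K \<rho> = lower (overlap k \<rho> \<sigma>) is}))
      = (\<Sum>\<sigma>\<in>S. \<Sum>J\<le>k+1. \<Sum>\<rho>\<in>S. w \<sigma> * (of_bool (degree_vector k K \<rho> = lower J is) * of_bool (overlap k \<rho> \<sigma> = J)))"
    unfolding split by (simp only: sum_distrib_left)
  also have "\<dots> = (\<Sum>J\<le>k+1. \<Sum>\<sigma>\<in>S. \<Sum>\<rho>\<in>S. w \<sigma> * (of_bool (degree_vector k K \<rho> = lower J is) * of_bool (overlap k \<rho> \<sigma> = J)))"
    by (rule sum.swap)
  also have "\<dots> = (\<Sum>J\<le>k+1. \<Sum>\<rho>\<in>S. \<Sum>\<sigma>\<in>S. w \<sigma> * (of_bool (degree_vector k K \<rho> = lower J is) * of_bool (overlap k \<rho> \<sigma> = J)))"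
    by (rule sum.cong[OF refl], rule sum.swap)
  also have "\<dots> = (\<Sum>J\<le>k+1. \<Sum>\<rho>\<in>S. of_bool (degree_vector k K \<rho> = lower J is) * (\<Sum>\<sigma>\<in>S. w \<sigma> * of_bool (overlap k \<rho> \<sigma> = J)))"
    by (simp only: sum_distrib_left mult_ac)
  also have "\<dots> = (\<Sum>J\<le>k+1. \<Sum>\<rho>\<in>S. of_bool (degree_vector k K \<rho> = lower J is) * c J)"
    by (intro sum.cong refl) (auto simp: cU)
  also have "\<dots> = (\<Sum>J\<le>k+1. c J * degree_count k K (lower J is))"
    by (simp only: N sum_distrib_left mult_ac)
  also have "\<dots> = c 0 * degree_count k K is + (\<Sum>m\<le>k. rate k \<delta> m is * degree_count k K (lower (m + 1) is))"
    unfolding Suc_eq_plus1[symmetric] by (subst sum.atMost_Suc_shift) (simp add: c_def)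
  finally have main: "(\<Sum>\<sigma>\<in>S. w \<sigma> * real (card {\<rho> \<in> S. degree_vector k K \<rho> = lower (overlap k \<rho> \<sigma>) is}))
    = c 0 * degree_count k K is + (\<Sum>m\<le>k. rate k \<delta> m is * degree_count k K (lower (m + 1) is))" .
  have tot: "(\<Sum>\<sigma>\<in>S. w \<sigma>) = T"
    using sum_weight_simplices[OF K, of \<delta>] by (simp add: S_def w_def T_def)
  have "(\<Sum>\<sigma>\<in>S. w \<sigma> * degree_count k (attach (n + 1 + k + 2) K \<sigma>) is)
      = (\<Sum>\<sigma>\<in>S. w \<sigma> * real (card {\<rho> \<in> S. degree_vector k K \<rho> = lower (overlap k \<rho> \<sigma>) is})
          + w \<sigma> * (real (k + 1) * of_bool (root_index k is)))"
    using degree_count_attach[OF K _ refl I] by (intro sum.cong refl) (simp add: S_def algebra_simps)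
  also have "\<dots> = c 0 * degree_count k K is + (\<Sum>m\<le>k. rate k \<delta> m is * degree_count k K (lower (m + 1) is))
      + T * (real (k + 1) * of_bool (root_index k is))"
    by (simp only: sum.distrib main sum_distrib_right[symmetric] tot)
  finally show ?thesis unfolding S_def w_def T_def c_def by (simp add: algebra_simps)
qed

text \<open>An old simplex can enter or leave the count only if its largest vertex lies in \<sigma>
  and has degree at most \<open>is ! 0\<close>. There are at most k + 1 such vertices, each in at
  most \<open>1 + k * (is ! 0)\<close> simplices of dimension k; the last k + 1 pays for the new
  simplices.\<close>

lemma degree_count_attach_diff:
  assumes K: "reachable k n K" and \<sigma>: "\<sigma> \<in> simplices k K" and v: "v = n + 1 + k + 2"
    and I: "is \<in> degree_indices k"
  shows "\<bar>real (degree_count k (attach v K \<sigma>) is) - real (degree_count k K is)\<bar>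
    \<le> real ((k + 1) * (1 + k * (is ! 0)) + (k + 1))"
proof -
  have len: "length is = k + 1" using I by (simp add: degree_indices_def)
  have s: "finite \<sigma>" "card \<sigma> = k + 1"
    using \<sigma> reachable_complex(5)[OF K] by (auto simp: simplices_def)
  have finK: "finite K" using reachable_complex(1)[OF K] .
  then have fin: "finite (simplices k K)" by (simp add: simplices_def)
  define A where "A = {\<rho> \<in> simplices k K. degree_vector k K \<rho> = lower (overlap k \<rho> \<sigma>) is}"
  define A0 where "A0 = {\<rho> \<in> simplices k K. degree_vector k K \<rho> = is}"
  define V where "V = {u \<in> \<sigma>. {u} \<in> K \<and> face_degree 0 K {u} \<le> is ! 0}"
  define C where "C = (\<Union>u\<in>V. cofaces (k + 1) K {u})"
  have finC: "finite C" using s finK by (auto simp: C_def V_def cofaces_def)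
  have sub: "\<rho> \<in> C" if \<rho>: "\<rho> \<in> simplices k K" and o: "overlap k \<rho> \<sigma> > 0" and d: "degree_vector k K \<rho> ! 0 \<le> is ! 0" for \<rho>
  proof -
    have fr: "finite \<rho>" "card \<rho> = k + 1"
      using \<rho> reachable_complex(5)[OF K] by (auto simp: simplices_def)
    obtain u where u: "top_face k 0 \<rho> = {u}"
      using top_face(2)[OF fr, of 0] by (auto simp: card_1_singleton_iff)
    have "{u} \<subseteq> \<sigma>" using overlap(2)[OF fr, of 0 \<sigma>] o u by simp
    moreover have "u \<in> \<rho>" using top_face(1)[OF fr, of 0] u by simp
    moreover have "{u} \<in> K" using top_face_simplex(1)[OF K \<rho>, of 0] u by simp
    moreover have "face_degree 0 K {u} \<le> is ! 0" using d u by (simp add: degree_vector_nth)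
    ultimately show ?thesis using \<rho> by (auto simp: C_def V_def cofaces_def simplices_def)
  qed
  \<comment> \<open>Since \<open>lower 0\<close> is the identity, a simplex in only one of the sets
    has positive overlap; lowering never increases the first entry.\<close>
  have "A - A0 \<subseteq> C" "A0 - A \<subseteq> C"
    using len by (auto simp: A_def A0_def lower_nth intro!: sub gr0I)
  then have "A \<subseteq> A0 \<union> C" "A0 \<subseteq> A \<union> C" by auto
  moreover have "finite A" "finite A0" using fin by (auto simp: A_def A0_def)
  ultimately have "card A \<le> card (A0 \<union> C)" "card A0 \<le> card (A \<union> C)"
    using finC by (auto intro: card_mono)
  then have "card A \<le> card A0 + card C" "card A0 \<le> card A + card C"
    using card_Un_le[of A0 C] card_Un_le[of A C] by linarith+
  moreover have "card C \<le> (\<Sum>u\<in>V. 1 + k * (is ! 0))"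
    unfolding C_def
  proof (rule order.trans[OF card_UN_le])
    show "finite V" using s by (simp add: V_def)
    show "(\<Sum>u\<in>V. card (cofaces (k + 1) K {u})) \<le> (\<Sum>u\<in>V. 1 + k * (is ! 0))"
    proof (rule sum_mono)
      fix u assume u: "u \<in> V"
      then have "card (cofaces (k + 2) K {u}) \<le> is ! 0"
        using face_degree_eq[OF K, of "{u}" 0] by (auto simp: V_def)
      moreover have "card (cofaces (k + 1) K {u}) = 1 + k * card (cofaces (k + 2) K {u})"
        using coface_counts(1)[OF K, of "{u}"] u by (simp add: V_def)
      ultimately show "card (cofaces (k + 1) K {u}) \<le> 1 + k * (is ! 0)" by simp
    qed
  qed
  moreover have "(\<Sum>u\<in>V. 1 + k * (is ! 0)) \<le> (k + 1) * (1 + k * (is ! 0))"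
  proof -
    have "card V \<le> k + 1" using card_mono[of \<sigma> V] s by (auto simp: V_def)
    then show ?thesis by (simp only: sum_constant of_nat_id mult_le_mono1)
  qed
  moreover have "degree_count k (attach v K \<sigma>) is = card A + (k + 1) * of_bool (root_index k is)"
    using degree_count_attach[OF K \<sigma> v I] by (simp add: A_def)
  moreover have "degree_count k K is = card A0" using degree_count_eq[OF len] by (simp add: A0_def)
  moreover have "(k + 1) * of_bool (root_index k is) \<le> k + 1" by simp
  ultimately have "real (degree_count k (attach v K \<sigma>) is) \<le> real (degree_count k K is) + real ((k + 1) * (1 + k * (is ! 0)) + (k + 1))"
    "real (degree_count k K is) \<le> real (degree_count k (attach v K \<sigma>) is) + real ((k + 1) * (1 + k * (is ! 0)) + (k + 1))"
    unfolding of_nat_add[symmetric] of_nat_le_iff by linarith+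
  then show ?thesis by linarith
qed

section \<open>Linear recursions with orthogonal noise\<close>

text \<open>A factor in [0, 1] does not enlarge the absolute value of \<open>e n\<close>, so
  eventually it grows by less than r / 2 per step; the other half of r absorbs the value at the
  starting index.\<close>

lemma perturbed_recursion_sublinear:
  fixes e a \<gamma> :: "nat \<Rightarrow> real"
  assumes e: "\<And>n. e (Suc n) = (1 - a n) * e n + \<gamma> n"
    and a: "\<forall>\<^sub>F n in sequentially. 0 \<le> a n \<and> a n \<le> 1"
    and \<gamma>: "\<gamma> \<longlonglongrightarrow> 0"
  shows "(\<lambda>n. e n / (real n + 1)) \<longlonglongrightarrow> 0"
proof (rule LIMSEQ_I)
  fix r :: real assume r: "r > 0"
  have "\<forall>\<^sub>F n in sequentially. \<bar>\<gamma> n\<bar> < r / 2"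
    using order_tendstoD(2)[OF tendsto_rabs[OF \<gamma>], of "r / 2"] r by simp
  then have "\<forall>\<^sub>F n in sequentially. (0 \<le> a n \<and> a n \<le> 1) \<and> \<bar>\<gamma> n\<bar> < r / 2"
    using a by (simp add: eventually_conj_iff)
  then obtain N where N: "\<And>n. n \<ge> N \<Longrightarrow> 0 \<le> a n \<and> a n \<le> 1 \<and> \<bar>\<gamma> n\<bar> < r / 2"
    unfolding eventually_sequentially by blast
  have bd: "\<bar>e n\<bar> \<le> \<bar>e N\<bar> + r / 2 * real (n - N)" if "n \<ge> N" for n
    using that
  proof (induction n rule: dec_induct)
    case (step n)
    have "\<bar>e (Suc n)\<bar> \<le> \<bar>(1 - a n) * e n\<bar> + \<bar>\<gamma> n\<bar>" unfolding e by (rule abs_triangle_ineq)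
    also have "\<bar>(1 - a n) * e n\<bar> \<le> \<bar>e n\<bar>"
      using N[of n] step(1) by (simp add: abs_mult mult_left_le_one_le)
    finally have "\<bar>e (Suc n)\<bar> \<le> \<bar>e N\<bar> + r / 2 * real (n - N) + r / 2"
      using step(3) N[OF step(1)] by linarith
    moreover have "real (Suc n - N) = real (n - N) + 1" using step(1) by simp
    ultimately show ?case by (simp only: distrib_left mult_1_right add.assoc)
  qed simp
  obtain N' where N': "real N' > 2 * \<bar>e N\<bar> / r" using reals_Archimedean2 by blast
  show "\<exists>no. \<forall>n\<ge>no. norm (e n / (real n + 1) - 0) < r"
  proof (intro exI allI impI)
    fix n assume n: "n \<ge> max N N'"
    have "real N' \<le> real n" using n by simp
    then have "2 * \<bar>e N\<bar> / r < real n" using N' by linarith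
    then have "\<bar>e N\<bar> < r / 2 * real n" using r by (simp add: field_simps)
    moreover have "r / 2 * real (n - N) \<le> r / 2 * real n" using r by simp
    ultimately have "\<bar>e n\<bar> < r * real n" using bd[of n] n by (simp add: field_simps)
    also have "\<dots> < r * (real n + 1)" using r by simp
    finally have "\<bar>e n\<bar> < r * (real n + 1)" .
    then show "norm (e n / (real n + 1) - 0) < r" by (simp add: field_simps)
  qed
qed

text \<open>Subtracting the accumulated noise and the guess L (n + 1) from \<open>x\<close> leaves a
  recursion whose source tends to (1 + A) L - L A - L = 0. The noise re-enters only through its
  average, multiplied by the convergent \<open>(real n + 1) * a n\<close>.\<close>

lemma linear_recursion_limit:
  fixes x a \<beta> \<xi> :: "nat \<Rightarrow> real"
  assumes x: "\<And>n. x (Suc n) = (1 - a n) * x n + \<beta> n + \<xi> n"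
    and a01: "\<forall>\<^sub>F n in sequentially. 0 \<le> a n \<and> a n \<le> 1"
    and a: "(\<lambda>n. (real n + 1) * a n) \<longlonglongrightarrow> A"
    and \<beta>: "\<beta> \<longlonglongrightarrow> (1 + A) * L"
    and \<xi>: "(\<lambda>n. (\<Sum>j<n. \<xi> j) / (real n + 1)) \<longlonglongrightarrow> 0"
  shows "(\<lambda>n. x n / (real n + 1)) \<longlonglongrightarrow> L"
proof -
  define S where "S n = (\<Sum>j<n. \<xi> j)" for n
  define e where "e n = x n - S n - L * (real n + 1)" for n
  define \<gamma> where "\<gamma> n = \<beta> n - ((real n + 1) * a n) * (S n / (real n + 1)) - L * ((real n + 1) * a n) - L" for n
  have "e (Suc n) = (1 - a n) * e n + \<gamma> n" for n
  proof -
    have "((real n + 1) * a n) * (S n / (real n + 1)) = a n * S n"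
      by (simp add: of_nat_neq_0 add.commute)
    then show ?thesis by (simp add: e_def \<gamma>_def x S_def algebra_simps)
  qed
  moreover have "\<gamma> \<longlonglongrightarrow> (1 + A) * L - A * 0 - L * A - L"
    unfolding \<gamma>_def using a \<beta> \<xi> by (intro tendsto_intros) (simp_all add: S_def)
  then have "\<gamma> \<longlonglongrightarrow> 0" by (simp add: algebra_simps)
  ultimately have "(\<lambda>n. e n / (real n + 1)) \<longlonglongrightarrow> 0"
    using a01 by (intro perturbed_recursion_sublinear)
  then have "(\<lambda>n. e n / (real n + 1) + S n / (real n + 1) + L) \<longlonglongrightarrow> 0 + 0 + L"
    using \<xi> unfolding S_def by (intro tendsto_intros)
  moreover have "e n / (real n + 1) + S n / (real n + 1) + L = x n / (real n + 1)" for n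
    by (simp add: e_def add_divide_distrib diff_divide_distrib)
  ultimately show ?thesis by simp
qed

text \<open>
  Second moments give convergence along the squares; boundedness of the increments fills the gaps.
\<close>

lemma (in prob_space) strong_law_orthogonal:
  fixes \<xi> :: "nat \<Rightarrow> 'a \<Rightarrow> real"
  assumes [measurable]: "\<And>n. \<xi> n \<in> borel_measurable M"
    and bound: "\<And>n. AE \<omega> in M. \<bar>\<xi> n \<omega>\<bar> \<le> C"
    and orth: "\<And>i j. i < j \<Longrightarrow> expectation (\<lambda>\<omega>. \<xi> i \<omega> * \<xi> j \<omega>) = 0"
  shows "AE \<omega> in M. (\<lambda>n. (\<Sum>j<n. \<xi> j \<omega>) / (real n + 1)) \<longlonglongrightarrow> 0"
proof -
  define S where "S n \<omega> = (\<Sum>j<n. \<xi> j \<omega>)" for n \<omega>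
  \<comment> \<open>Orthogonality bounds the second moment of the average by a multiple of 1 / n,
    which is summable along the squares.\<close>
  define Z where "Z m \<omega> = (S (m^2) \<omega> / (real (m^2) + 1))^2" for m \<omega>
  have [measurable]: "S n \<in> borel_measurable M" "Z n \<in> borel_measurable M" for n
    unfolding S_def Z_def by measurable
  have prodbd: "AE \<omega> in M. norm (\<xi> i \<omega> * \<xi> j \<omega>) \<le> C\<^sup>2" for i j
    using bound[of i] bound[of j]
    by eventually_elim (auto simp: abs_mult power2_eq_square intro!: mult_mono)
  have int: "integrable M (\<lambda>\<omega>. \<xi> i \<omega> * \<xi> j \<omega>)" for i j
    by (rule integrable_const_bound[OF prodbd]) measurable
  have sq: "(S n \<omega>)^2 = (\<Sum>i<n. \<Sum>j<n. \<xi> i \<omega> * \<xi> j \<omega>)" for n \<omega>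
    by (simp add: S_def power2_eq_square sum_product)
  have intS: "integrable M (\<lambda>\<omega>. (S n \<omega>)^2)" for n
    unfolding sq using int by simp
  have ES: "expectation (\<lambda>\<omega>. (S n \<omega>)^2) \<le> real n * C\<^sup>2" for n
  proof -
    have "expectation (\<lambda>\<omega>. (S n \<omega>)^2) = (\<Sum>i<n. \<Sum>j<n. expectation (\<lambda>\<omega>. \<xi> i \<omega> * \<xi> j \<omega>))"
      unfolding sq using int by (simp add: Bochner_Integration.integral_sum)
    also have "\<dots> \<le> (\<Sum>i<n. \<Sum>j<n. if i = j then C\<^sup>2 else 0)"
    proof (intro sum_mono)
      fix i j
      show "expectation (\<lambda>\<omega>. \<xi> i \<omega> * \<xi> j \<omega>) \<le> (if i = j then C\<^sup>2 else 0)"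
      proof (cases i j rule: linorder_cases)
        case equal
        have "expectation (\<lambda>\<omega>. \<xi> i \<omega> * \<xi> j \<omega>) \<le> expectation (\<lambda>\<omega>. C\<^sup>2)"
          using prodbd[of i j] by (intro integral_mono_AE int) (auto elim: eventually_mono)
        then show ?thesis using equal by (simp add: prob_space)
      next
        case greater
        then show ?thesis using orth[of j i] by (simp add: mult.commute)
      qed (use orth in simp)
    qed
    also have "\<dots> = real n * C\<^sup>2" by simp
    finally show ?thesis .
  qed
  have intZ: "integrable M (Z m)" for m
    using intS[of "m^2"] unfolding Z_def power_divide by simp
  have EZ: "expectation (Z m) \<le> C\<^sup>2 * inverse (real m ^ 2)" for m
  proof -
    have "expectation (Z m) = expectation (\<lambda>\<omega>. (S (m^2) \<omega>)^2) / (real (m^2) + 1)^2"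
      unfolding Z_def power_divide by simp
    also have "\<dots> \<le> real (m^2) * C\<^sup>2 / (real (m^2) + 1)^2"
      by (intro divide_right_mono ES) simp
    also have "\<dots> \<le> C\<^sup>2 * inverse (real m ^ 2)"
    \<comment> \<open>At m = 0 both sides vanish, because \<open>inverse 0 = 0\<close>.\<close>
    proof (cases "m = 0")
      case False
      have "real (m^2) * C\<^sup>2 / (real (m^2) + 1)^2 \<le> real (m^2) * C\<^sup>2 / (real (m^2))^2"
        using False by (intro divide_left_mono power_mono)
          (auto intro!: mult_pos_pos zero_less_power add_nonneg_pos)
      also have "\<dots> = C\<^sup>2 * inverse (real m ^ 2)" using False by (simp add: field_simps power2_eq_square)
      finally show ?thesis .
    qed simp
    finally show ?thesis .
  qed
  have Znn: "Z m \<omega> \<ge> 0" for m \<omega> by (simp add: Z_def)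
  have sumEZ: "summable (\<lambda>m. expectation (Z m))"
    by (rule summable_comparison_test'[OF summable_mult[OF inverse_power_summable[of 2, where 'a=real], of "C\<^sup>2"]])
      (use EZ Znn in \<open>auto intro!: integral_nonneg\<close>)
  \<comment> \<open>Exchanging sum and integral turns summable expectations into almost sure
    summability of \<open>Z\<close>.\<close>
  have "(\<integral>\<^sup>+\<omega>. (\<Sum>m. ennreal (Z m \<omega>)) \<partial>M) = (\<Sum>m. \<integral>\<^sup>+\<omega>. ennreal (Z m \<omega>) \<partial>M)"
    by (rule nn_integral_suminf) measurable
  also have "\<dots> = (\<Sum>m. ennreal (expectation (Z m)))"
    using intZ Znn by (intro suminf_cong nn_integral_eq_integral) auto
  also have "\<dots> = ennreal (\<Sum>m. expectation (Z m))"
    using sumEZ Znn by (intro suminf_ennreal2) (auto intro!: integral_nonneg)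
  finally have "(\<integral>\<^sup>+\<omega>. (\<Sum>m. ennreal (Z m \<omega>)) \<partial>M) \<noteq> \<infinity>" by simp
  then have "AE \<omega> in M. (\<Sum>m. ennreal (Z m \<omega>)) \<noteq> \<infinity>"
    by (intro nn_integral_PInf_AE) auto
  then have AEZ: "AE \<omega> in M. summable (\<lambda>m. Z m \<omega>)"
    by eventually_elim (rule summable_suminf_not_top[OF Znn], auto)
  have "AE \<omega> in M. \<forall>n. \<bar>\<xi> n \<omega>\<bar> \<le> C" using bound by (simp add: AE_all_countable)
  with AEZ show ?thesis
  proof eventually_elim
    case (elim \<omega>)
    have C: "C \<ge> 0" using elim(2) by (meson abs_ge_zero order_trans)
    have "(\<lambda>m. Z m \<omega>) \<longlonglongrightarrow> 0" using elim(1) by (rule summable_LIMSEQ_zero)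
    then have "(\<lambda>m. sqrt (Z m \<omega>)) \<longlonglongrightarrow> sqrt 0" by (rule tendsto_real_sqrt)
    then have l1: "(\<lambda>m. \<bar>S (m^2) \<omega>\<bar> / (real (m^2) + 1)) \<longlonglongrightarrow> 0"
      by (simp add: Z_def real_sqrt_abs abs_div_pos)
    have "(\<lambda>m. C * (2 * (real m / (real (m^2) + 1)))) \<longlonglongrightarrow> C * (2 * 0)"
    proof (intro tendsto_intros)
      show "(\<lambda>m. real m / (real (m^2) + 1)) \<longlonglongrightarrow> 0"
      proof (rule tendsto_sandwich[OF _ _ tendsto_const lim_inverse_n'])
        show "\<forall>\<^sub>F m in sequentially. real m / (real (m^2) + 1) \<le> 1 / real m"
          using eventually_gt_at_top[of 0]
        proof eventually_elim
          case (elim m)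
          have "real m / (real (m^2) + 1) \<le> real m / real (m^2)"
            using elim by (intro divide_left_mono) (auto intro!: mult_pos_pos add_nonneg_pos)
          then show ?case using elim by (simp add: power2_eq_square)
        qed
      qed simp
    qed
    then have l2: "(\<lambda>m. \<bar>S (m^2) \<omega>\<bar> / (real (m^2) + 1) + C * (2 * (real m / (real (m^2) + 1)))) \<longlonglongrightarrow> 0"
      using tendsto_add[OF l1] by fastforce
    have "filterlim floor_sqrt at_top sequentially"
      unfolding filterlim_at_top eventually_sequentially by (metis le_floor_sqrtI)
    then have l3: "(\<lambda>n. \<bar>S ((floor_sqrt n)^2) \<omega>\<bar> / (real ((floor_sqrt n)^2) + 1)
        + C * (2 * (real (floor_sqrt n) / (real ((floor_sqrt n)^2) + 1)))) \<longlonglongrightarrow> 0"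
      by (rule filterlim_compose[OF l2])
    show ?case
    proof (rule Lim_null_comparison[OF always_eventually l3], rule allI)
      fix n
      \<comment> \<open>From m^2 to n there are at most 2 m increments, each bounded by C, which is
        negligible against m^2.\<close>
      define m where "m = floor_sqrt n"
      have m: "m^2 \<le> n" "n < (Suc m)^2" by (simp_all add: m_def Suc_floor_sqrt_power2_gt)
      have "S n \<omega> = S (m^2) \<omega> + (\<Sum>j\<in>{m^2..<n}. \<xi> j \<omega>)"
        unfolding S_def using m(1) by (metis atLeast0LessThan sum.atLeastLessThan_concat zero_le)
      moreover have "\<bar>\<Sum>j\<in>{m^2..<n}. \<xi> j \<omega>\<bar> \<le> (\<Sum>j\<in>{m^2..<n}. C)"
        using elim(2) by (intro sum_abs[THEN order_trans] sum_mono) auto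
      moreover have "(\<Sum>j\<in>{m^2..<n}. C) \<le> C * (2 * real m)"
      proof -
        have "n - m^2 \<le> 2 * m" using m(2) by (simp add: power2_eq_square)
        then have "real (n - m^2) \<le> 2 * real m" by linarith
        then show ?thesis using C by (simp add: mult.commute mult_left_mono)
      qed
      ultimately have "\<bar>S n \<omega>\<bar> \<le> \<bar>S (m^2) \<omega>\<bar> + C * (2 * real m)" by linarith
      then have "\<bar>S n \<omega>\<bar> / (real n + 1) \<le> (\<bar>S (m^2) \<omega>\<bar> + C * (2 * real m)) / (real (m^2) + 1)"
        using m(1) C by (intro frac_le) (auto simp flip: of_nat_power)
      then show "norm ((\<Sum>j<n. \<xi> j \<omega>) / (real n + 1)) \<le> \<bar>S ((floor_sqrt n)^2) \<omega>\<bar> / (real ((floor_sqrt n)^2) + 1)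
        + C * (2 * (real (floor_sqrt n) / (real ((floor_sqrt n)^2) + 1)))"
        unfolding m_def[symmetric] S_def[symmetric]
        by (simp only: add_divide_distrib times_divide_eq_right real_norm_def abs_divide
            abs_of_nonneg[OF add_nonneg_nonneg[OF of_nat_0_le_iff zero_le_one]])
    qed
  qed
qed

section \<open>Total mass of the limit\<close>

text \<open>The coefficient equals 1 + (1 + \<delta>) (k - m).\<close>

lemma b_coeff_ge_1:
  assumes "\<delta> > -1" "m \<le> k"
  shows "b_coeff k \<delta> m \<ge> 1"
proof -
  have "0 \<le> (1 + \<delta>) * (real k - real m)" using assms by simp
  then show ?thesis by (simp add: b_coeff_def algebra_simps)
qed

lemma b_coeff_Suc_le:
  assumes "\<delta> > -1"
  shows "b_coeff k \<delta> (Suc m) \<le> b_coeff k \<delta> m"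
  using assms by (simp add: b_coeff_def algebra_simps)

lemma b_coeff_self [simp]: "b_coeff k \<delta> k = 1"
  by (simp add: b_coeff_def)

text \<open>The second quantity is (k + 2) (1 + \<delta>), the total weight of the initial
  complex.\<close>

lemma tau_pos:
  assumes "\<delta> > -1"
  shows "tau k \<delta> > 0" "tau k \<delta> + \<delta> > 0"
proof -
  have "0 \<le> (1 + \<delta>) * real k" using assms by simp
  then show "tau k \<delta> > 0" "tau k \<delta> + \<delta> > 0" using assms by (simp_all add: tau_def algebra_simps)
qed

lemma degree_index_0_gt:
  assumes "is \<in> degree_indices k"
  shows "is ! 0 > k"
  using sorted_gt_nth_lower_bound[OF assms, of 0] by simp

lemma exit_rate_pos:
  assumes "is \<in> degree_indices k" "\<delta> > -1"
  shows "exit_rate k \<delta> is > 0"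
proof -
  have "1 * 1 \<le> (real (is ! 0) - real k) * b_coeff k \<delta> 0"
    using degree_index_0_gt[OF assms(1)] b_coeff_ge_1[OF assms(2), of 0 k] by (intro mult_mono) auto
  then show ?thesis using assms(2) by (simp add: exit_rate_def)
qed

text \<open>The isolated first term of the recursion is the summand m = k of the rates.\<close>

lemma degree_recursion_rate:
  assumes "degree_recursion k \<delta> p" "is \<in> degree_indices k"
  shows "(1 + exit_rate k \<delta> is / tau k \<delta>) * p is
    = (\<Sum>m\<le>k. rate k \<delta> m is / tau k \<delta> * zero_ext k p (lower (m + 1) is)) + of_bool (root_index k is)"
proof -
  have "p is = (\<Sum>m\<le>k. rate k \<delta> m is / tau k \<delta> * zero_ext k p (lower (m + 1) is))
      - exit_rate k \<delta> is / tau k \<delta> * p is + of_bool (root_index k is)"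
    using bspec[OF assms(1)[unfolded degree_recursion_def] assms(2)]
    unfolding lessThan_Suc_atMost[symmetric] sum.lessThan_Suc
    by (simp add: rate_def exit_rate_def root_index_def)
  then show ?thesis by (simp add: algebra_simps)
qed

text \<open>A rate can be negative, but not where the lowered tuple is admissible: then entry m
  exceeds entry m + 1 by at least 2, and the first product has the larger factors. For m = k the
  last entry is at least 2, which leaves at least 1 + \<delta>.\<close>

lemma rate_nonneg:
  assumes \<delta>: "\<delta> > -1" and m: "m \<le> k" and I: "is \<in> degree_indices k" and L: "lower (m + 1) is \<in> degree_indices k"
  shows "rate k \<delta> m is \<ge> 0"
proof (cases "m < k")
  case True
  have len: "length is = k + 1" using I by (simp add: degree_indices_def)
  have "lower (m + 1) is ! Suc m < lower (m + 1) is ! m"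
    using L True by (auto simp: degree_indices_def sorted_wrt_iff_nth_less)
  then have "is ! Suc m < is ! m - 1" using len True by (simp add: lower_nth)
  then have "real (is ! Suc m) - real k + real m + 1 \<le> real (is ! m) - 1 - real k + real m" by linarith
  moreover have "is ! Suc m \<ge> k - Suc m + 1"
    using sorted_gt_nth_lower_bound[OF I, of "Suc m"] True by simp
  then have "0 \<le> real (is ! Suc m) - real k + real m + 1" using True by linarith
  moreover have "0 \<le> b_coeff k \<delta> m" using b_coeff_ge_1[OF \<delta> m] by simp
  ultimately have "(real (is ! Suc m) - real k + real m + 1) * b_coeff k \<delta> (Suc m)
      \<le> (real (is ! m) - 1 - real k + real m) * b_coeff k \<delta> m"
    using b_coeff_Suc_le[OF \<delta>, of k m] b_coeff_ge_1[OF \<delta>, of "Suc m" k] True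
    by (intro mult_mono) auto
  then show ?thesis using True by (simp add: rate_def)
next
  case False
  then have "m = k" using m by simp
  then have "1 \<le> lower (k + 1) is ! k" "length is = k + 1" using L I by (auto simp: degree_indices_def)
  then have "is ! k \<ge> 2" by (simp add: lower_nth)
  then have "real (is ! k) \<ge> 2" by linarith
  then show ?thesis using \<delta> False by (simp add: rate_def)
qed

lemma degree_recursion_nonneg:
  assumes rec: "degree_recursion k \<delta> p" and \<delta>: "\<delta> > -1" and "is \<in> degree_indices k"
  shows "p is \<ge> 0"
  using assms(3)
proof (induction "is ! 0" arbitrary: "is" rule: less_induct)
  case less
  have "rate k \<delta> m is / tau k \<delta> * zero_ext k p (lower (m + 1) is) \<ge> 0" if "m \<le> k" for m
  proof (cases "lower (m + 1) is \<in> degree_indices k")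
    case True
    then have "p (lower (m + 1) is) \<ge> 0"
      using less.hyps lower_nth_0_less[OF less.prems, of m] by simp
    then show ?thesis
      using rate_nonneg[OF \<delta> that less.prems True] tau_pos(1)[OF \<delta>, of k] by (simp add: zero_ext_def)
  qed (simp add: zero_ext_def)
  then have "(1 + exit_rate k \<delta> is / tau k \<delta>) * p is \<ge> 0"
    unfolding degree_recursion_rate[OF rec less.prems] by (intro add_nonneg_nonneg sum_nonneg) auto
  moreover have "1 + exit_rate k \<delta> is / tau k \<delta> > 0"
    using exit_rate_pos[OF less.prems \<delta>] tau_pos(1)[OF \<delta>, of k] by (simp add: add_pos_pos)
  ultimately show ?case by (simp add: zero_le_mult_iff)
qed

section \<open>Balance of mass between consecutive levels\<close>

definition raise :: "nat \<Rightarrow> nat list \<Rightarrow> nat list" where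
  "raise j is = map Suc (take j is) @ drop j is"

lemma length_raise [simp]: "length (raise J is) = length is"
  by (simp add: raise_def)

lemma raise_nth: "i < length is \<Longrightarrow> raise J is ! i = (if i < J then Suc (is ! i) else is ! i)"
  by (auto simp: raise_def nth_append min_def)

text \<open>Raising an initial segment keeps the order strict, whereas lowering can leave the index
  set. Thus no outgoing mass is lost.\<close>

lemma raise_in_degree_indices:
  assumes "is \<in> degree_indices k"
  shows "raise J is \<in> degree_indices k"
proof -
  have len: "length is = k + 1" and "1 \<le> is ! k" using assms by (auto simp: degree_indices_def)
  moreover have "raise J is ! j < raise J is ! i" if "i < j" "j < k + 1" for i j
  proof -
    have "is ! j < is ! i"
      using assms that len by (auto simp: degree_indices_def sorted_wrt_iff_nth_less)
    then show ?thesis using that len by (simp add: raise_nth)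
  qed
  ultimately show ?thesis by (auto simp: degree_indices_def sorted_wrt_iff_nth_less raise_nth)
qed

lemma lower_raise [simp]: "lower J (raise J is) = is"
  by (rule nth_equalityI) (auto simp: lower_nth raise_nth)

lemma raise_lower:
  assumes "is \<in> degree_indices k"
  shows "raise J (lower J is) = is"
proof (rule nth_equalityI)
  fix i assume "i < length (raise J (lower J is))"
  then show "raise J (lower J is) ! i = is ! i"
    using sorted_gt_nth_lower_bound[OF assms, of i] assms
    by (auto simp: lower_nth raise_nth degree_indices_def)
qed simp

text \<open>At the raised tuples the -1 in the rates cancels, so they become consecutive differences
  of \<open>t\<close> and telescope.\<close>

lemma sum_rate_raise:
  assumes I: "is \<in> degree_indices k"
  shows "(\<Sum>m\<le>k. rate k \<delta> m (raise (m + 1) is)) = exit_rate k \<delta> is"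
proof -
  have len: "length is = k + 1" using I by (simp add: degree_indices_def)
  define t where "t m = (real (is ! m) - real k + real m) * b_coeff k \<delta> m" for m
  have "(\<Sum>m\<le>k. rate k \<delta> m (raise (m + 1) is)) = (\<Sum>m<k. t m - t (Suc m)) + (t k + \<delta>)"
    unfolding lessThan_Suc_atMost[symmetric] sum.lessThan_Suc
    using len by (intro arg_cong2[of _ _ _ _ "(+)"] sum.cong) (auto simp: rate_def t_def raise_nth algebra_simps)
  also have "\<dots> = t 0 + \<delta>" by (simp add: sum_lessThan_telescope')
  also have "\<dots> = exit_rate k \<delta> is" by (simp add: t_def exit_rate_def)
  finally show ?thesis .
qed

definition degree_level :: "nat \<Rightarrow> nat \<Rightarrow> nat list set" where
  "degree_level k l = {is \<in> degree_indices k. is ! 0 = l}"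

lemma finite_degree_level: "finite (degree_level k l)"
proof (rule finite_subset)
  show "degree_level k l \<subseteq> {xs. set xs \<subseteq> {..l} \<and> length xs = k + 1}"
  proof safe
    fix "is" x assume I: "is \<in> degree_level k l" and x: "x \<in> set is"
    then obtain i where i: "i < length is" "x = is ! i" by (auto simp: in_set_conv_nth)
    have "is ! i \<le> is ! 0" using I i by (cases "i = 0")
        (auto simp: degree_level_def degree_indices_def sorted_wrt_iff_nth_less intro!: less_imp_le)
    then show "x \<le> l" using I i by (simp add: degree_level_def)
  qed (simp add: degree_level_def degree_indices_def)
qed (rule finite_lists_length_eq, simp)

lemma sum_root_index: "(\<Sum>is\<in>degree_level k l. of_bool (root_index k is)) = (of_bool (l = k + 1) :: real)"
proof -
  define r where "r = map (\<lambda>l. k - l + 1) [0..<k + 1]"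
  have nth: "r ! l = k - l + 1" if "l \<le> k" for l using that by (simp add: r_def del: upt_Suc)
  have len: "length r = k + 1" by (simp add: r_def)
  have r: "r \<in> degree_indices k"
    using len nth by (auto simp: degree_indices_def sorted_wrt_iff_nth_less)
  have "root_index k is \<longleftrightarrow> is = r" if "is \<in> degree_indices k" for "is"
    using that len nth by (auto simp: root_index_def degree_indices_def list_eq_iff_nth_eq less_Suc_eq_le)
  then have "(\<Sum>is\<in>degree_level k l. of_bool (root_index k is)) = (\<Sum>is\<in>degree_level k l. if is = r then 1 else 0 :: real)"
    by (intro sum.cong) (auto simp: degree_level_def)
  also have "\<dots> = of_bool (l = k + 1)"
    using r nth[of 0] finite_degree_level by (auto simp: degree_level_def)
  finally show ?thesis .
qed

text \<open>Inflow into a level rewritten as outflow from the level below, through the bijection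
  given by \<open>raise\<close> and \<open>lower\<close>.\<close>

lemma sum_level_lower:
  assumes m: "m \<le> k"
  shows "(\<Sum>is\<in>degree_level k (Suc l). rate k \<delta> m is * zero_ext k p (lower (m + 1) is))
    = (\<Sum>js\<in>degree_level k l. rate k \<delta> m (raise (m + 1) js) * p js)"
proof -
  have "(\<Sum>is\<in>degree_level k (Suc l). rate k \<delta> m is * zero_ext k p (lower (m + 1) is))
    = (\<Sum>is\<in>{is \<in> degree_level k (Suc l). lower (m + 1) is \<in> degree_indices k}. rate k \<delta> m is * p (lower (m + 1) is))"
    using finite_degree_level by (intro sum.mono_neutral_cong_right) (auto simp: zero_ext_def)
  also have "\<dots> = (\<Sum>js\<in>degree_level k l. rate k \<delta> m (raise (m + 1) js) * p js)"
  proof (rule sum.reindex_bij_witness[where i = "raise (m + 1)" and j = "lower (m + 1)"])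
    fix js assume "js \<in> degree_level k l"
    then show "raise (m + 1) js \<in> {is \<in> degree_level k (Suc l). lower (m + 1) is \<in> degree_indices k}"
      using raise_in_degree_indices[of js k "m + 1"]
      by (auto simp: degree_level_def raise_nth degree_indices_def[of k])
  next
    fix "is" assume "is \<in> {is \<in> degree_level k (Suc l). lower (m + 1) is \<in> degree_indices k}"
    then show "lower (m + 1) is \<in> degree_level k l"
      by (auto simp: degree_level_def lower_nth degree_indices_def[of k])
  qed (auto simp: raise_lower degree_level_def)
  finally show ?thesis .
qed

text \<open>Level L + 1 receives exactly what leaves level L, plus a unit source if L = k; the claim
  is the sum of these balances. Levels up to k are empty.\<close>

lemma degree_recursion_level_sums:
  assumes rec: "degree_recursion k \<delta> p" and \<delta>: "\<delta> > -1"
  defines "s l \<equiv> \<Sum>is\<in>degree_level k l. p is"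
    and "W l \<equiv> ((real l - real k) * b_coeff k \<delta> 0 + \<delta>) / tau k \<delta>"
  shows "(\<Sum>l\<le>L. s l) + W L * s L = of_bool (L > k)"
proof (induction L)
  case 0
  have "degree_level k 0 = {}" using degree_index_0_gt by (force simp: degree_level_def)
  then show ?case by (simp add: s_def)
next
  case (Suc L)
  have W: "exit_rate k \<delta> is / tau k \<delta> = W l" if "is \<in> degree_level k l" for "is" l
    using that by (simp add: exit_rate_def W_def degree_level_def)
  have "(1 + W (Suc L)) * s (Suc L) = (\<Sum>is\<in>degree_level k (Suc L). (1 + exit_rate k \<delta> is / tau k \<delta>) * p is)"
    unfolding s_def sum_distrib_left by (intro sum.cong) (simp_all add: W)
  also have "\<dots> = (\<Sum>is\<in>degree_level k (Suc L).
      (\<Sum>m\<le>k. rate k \<delta> m is / tau k \<delta> * zero_ext k p (lower (m + 1) is)) + of_bool (root_index k is))"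
    using degree_recursion_rate[OF rec] by (intro sum.cong) (auto simp: degree_level_def)
  also have "\<dots> = (\<Sum>m\<le>k. \<Sum>is\<in>degree_level k (Suc L). rate k \<delta> m is / tau k \<delta> * zero_ext k p (lower (m + 1) is))
      + of_bool (L = k)"
    unfolding sum.distrib sum_root_index by (subst sum.swap) simp
  also have "(\<Sum>m\<le>k. \<Sum>is\<in>degree_level k (Suc L). rate k \<delta> m is / tau k \<delta> * zero_ext k p (lower (m + 1) is))
      = (\<Sum>m\<le>k. \<Sum>js\<in>degree_level k L. rate k \<delta> m (raise (m + 1) js) * p js) / tau k \<delta>"
    unfolding sum_divide_distrib[of _ "{..k}"]
    by (rule sum.cong[OF refl], subst sum_level_lower[symmetric]) (simp_all add: sum_divide_distrib)
  also have "\<dots> = (\<Sum>js\<in>degree_level k L. exit_rate k \<delta> js * p js) / tau k \<delta>"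
    by (subst sum.swap) (auto simp: sum_distrib_right[symmetric] sum_rate_raise[simplified]
        degree_level_def intro!: sum.cong)
  also have "\<dots> = W L * s L"
    unfolding s_def sum_distrib_left sum_divide_distrib by (intro sum.cong) (simp_all add: W[symmetric])
  finally have "(1 + W (Suc L)) * s (Suc L) = W L * s L + of_bool (L = k)" .
  then show ?case using Suc by (auto simp: algebra_simps less_Suc_eq)
qed

lemma degree_recursion_level_sums_sums:
  assumes rec: "degree_recursion k \<delta> p" and \<delta>: "\<delta> > -1"
  shows "(\<lambda>l. \<Sum>is\<in>degree_level k l. p is) sums 1"
proof -
  define s where "s l = (\<Sum>is\<in>degree_level k l. p is)" for l
  define W where "W l = ((real l - real k) * b_coeff k \<delta> 0 + \<delta>) / tau k \<delta>" for l
  have eq: "(\<Sum>l\<le>L. s l) + W L * s L = of_bool (L > k)" for L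
    unfolding s_def W_def by (rule degree_recursion_level_sums[OF rec \<delta>])
  have s0: "s l \<ge> 0" for l
    unfolding s_def by (intro sum_nonneg degree_recursion_nonneg[OF rec \<delta>]) (simp add: degree_level_def)
  have W0: "W l \<ge> 0" if "l > k" for l
  proof -
    have "1 * 1 \<le> (real l - real k) * b_coeff k \<delta> 0"
      using that b_coeff_ge_1[OF \<delta>, of 0 k] by (intro mult_mono) auto
    then show ?thesis using \<delta> tau_pos(1)[OF \<delta>, of k] by (simp add: W_def)
  qed
  \<comment> \<open>The identity is read off at an index beyond k, where \<open>W\<close> is
    nonnegative; the partial sums increase.\<close>
  have le1: "(\<Sum>l\<le>L. s l) \<le> 1" for L
  proof -
    have "(\<Sum>l\<le>L. s l) \<le> (\<Sum>l\<le>L + k + 1. s l)" using s0 by (intro sum_mono2) auto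
    moreover have "W (L + k + 1) * s (L + k + 1) \<ge> 0" using W0 s0 by simp
    ultimately show ?thesis using eq[of "L + k + 1"] by simp
  qed
  have summ: "summable s" using s0 le1 by (intro bounded_imp_summable)
  have "suminf s = 1"
  proof (rule ccontr)
    assume "suminf s \<noteq> 1"
    moreover have "suminf s \<le> 1"
      using LIMSEQ_le_const2[OF summable_LIMSEQ'[OF summ], of 1] le1 by blast
    ultimately have c: "1 - suminf s > 0" by simp
    \<comment> \<open>\<open>B\<close> is the slope of a linear bound for \<open>W\<close>. If mass
      were missing, \<open>W l * s l\<close> would stay above a positive constant, so
      \<open>s l\<close> would dominate a multiple of 1 / l.\<close>
    define B where "B = (b_coeff k \<delta> 0 + 1 + \<bar>\<delta>\<bar>) / tau k \<delta>"
    have B: "B > 0" using b_coeff_ge_1[OF \<delta>, of 0 k] tau_pos(1)[OF \<delta>, of k] by (simp add: B_def)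
    have "summable (\<lambda>l. inverse (real l))"
    proof (rule summable_comparison_test_ev[OF _ summable_mult[OF summ]])
      show "\<forall>\<^sub>F l in sequentially. norm (inverse (real l)) \<le> B / (1 - suminf s) * s l"
        using eventually_gt_at_top[of k]
      proof eventually_elim
        case (elim l)
        have "(\<Sum>l\<le>l. s l) \<le> suminf s" using s0 by (intro sum_le_suminf summ) auto
        then have "1 - suminf s \<le> W l * s l" using eq[of l] elim by simp
        also have "W l \<le> B * real l"
        proof -
          have "(real l - real k) * b_coeff k \<delta> 0 \<le> real l * b_coeff k \<delta> 0"
            using b_coeff_ge_1[OF \<delta>, of 0 k] by (intro mult_right_mono) auto
          moreover have "\<bar>\<delta>\<bar> \<le> real l * \<bar>\<delta>\<bar>" using elim by (simp add: mult_le_cancel_right1)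
          ultimately have "(real l - real k) * b_coeff k \<delta> 0 + \<delta> \<le> (b_coeff k \<delta> 0 + 1 + \<bar>\<delta>\<bar>) * real l"
            by (simp add: algebra_simps)
          then show ?thesis using tau_pos(1)[OF \<delta>, of k] by (simp add: W_def B_def divide_right_mono)
        qed
        then have "W l * s l \<le> B * real l * s l" using s0 by (intro mult_right_mono)
        finally have "1 - suminf s \<le> B * real l * s l" .
        then show ?case using c elim by (simp add: field_simps)
      qed
    qed
    then show False using not_summable_harmonic[where 'a = real] by simp
  qed
  then show ?thesis using summ unfolding s_def by (simp add: sums_iff)
qed

text \<open>The levels are disjoint, finite and cover the index set; by nonnegativity the total mass
  may be summed level by level.\<close>

lemma degree_recursion_pmf:
  assumes rec: "degree_recursion k \<delta> p" and \<delta>: "\<delta> > -1"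
  shows "\<exists>P :: nat list pmf. \<forall>is. pmf P is = (if is \<in> degree_indices k then p is else 0)"
proof -
  define q where "q = zero_ext k p"
  have q0: "q is \<ge> 0" for "is"
    using degree_recursion_nonneg[OF rec \<delta>] by (simp add: q_def zero_ext_def)
  have disj: "disjoint_family (degree_level k)"
    by (auto simp: disjoint_family_on_def degree_level_def)
  have "(\<integral>\<^sup>+is. ennreal (q is) \<partial>count_space UNIV)
      = (\<integral>\<^sup>+is. (\<Sum>l. ennreal (q is) * indicator (degree_level k l) is) \<partial>count_space UNIV)"
  proof (rule nn_integral_cong)
    fix "is" :: "nat list"
    show "ennreal (q is) = (\<Sum>l. ennreal (q is) * indicator (degree_level k l) is)"
    proof (cases "is \<in> degree_indices k")
      case True
      then have "is \<in> degree_level k (is ! 0)" by (simp add: degree_level_def)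
      from suminf_cmult_indicator[OF disj this, of "\<lambda>_. ennreal (q is)"] show ?thesis by simp
    qed (simp add: q_def zero_ext_def)
  qed
  also have "\<dots> = (\<Sum>l. \<integral>\<^sup>+is. ennreal (q is) * indicator (degree_level k l) is \<partial>count_space UNIV)"
    by (rule nn_integral_suminf) simp
  also have "\<dots> = (\<Sum>l. ennreal (\<Sum>is\<in>degree_level k l. p is))"
  proof (rule suminf_cong)
    fix l
    have "(\<integral>\<^sup>+is. ennreal (q is) * indicator (degree_level k l) is \<partial>count_space UNIV)
        = (\<Sum>is\<in>degree_level k l. ennreal (q is))"
      using finite_degree_level
      by (simp add: nn_integral_count_space_indicator[symmetric] nn_integral_count_space_finite)
    also have "\<dots> = ennreal (\<Sum>is\<in>degree_level k l. q is)" using q0 by simp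
    also have "(\<Sum>is\<in>degree_level k l. q is) = (\<Sum>is\<in>degree_level k l. p is)"
      by (intro sum.cong) (auto simp: q_def zero_ext_def degree_level_def)
    finally show "(\<integral>\<^sup>+is. ennreal (q is) * indicator (degree_level k l) is \<partial>count_space UNIV)
        = ennreal (\<Sum>is\<in>degree_level k l. p is)" .
  qed
  also have "\<dots> = ennreal 1"
    using degree_recursion_level_sums_sums[OF rec \<delta>] degree_recursion_nonneg[OF rec \<delta>]
    by (subst suminf_ennreal2) (auto simp: sums_iff degree_level_def intro!: sum_nonneg)
  finally have "pmf (embed_pmf q) is = q is" for "is"
    using q0 by (intro pmf_embed_pmf) auto
  then show ?thesis unfolding q_def zero_ext_def by blast
qed

section \<open>The process along its finitely many histories\<close>

text \<open>Possible paths up to time n, padded with \<open>{}\<close> afterwards so that each path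
  has exactly one representing function.\<close>

fun histories :: "nat \<Rightarrow> nat \<Rightarrow> (nat \<Rightarrow> nat set set) set" where
  "histories k 0 = {\<lambda>j. if j = 0 then full_simplex {1..k + 2} else {}}"
| "histories k (Suc n) = (\<lambda>(h, \<sigma>). h(Suc n := attach (n + 1 + k + 2) (h n) \<sigma>))
    ` (SIGMA h : histories k n. simplices k (h n))"

lemma histories_SucE:
  assumes "h \<in> histories k (Suc n)"
  obtains h' \<sigma> where "h' \<in> histories k n" "\<sigma> \<in> simplices k (h' n)"
    "h = h'(Suc n := attach (n + 1 + k + 2) (h' n) \<sigma>)"
  using assms by auto

lemma histories_reachable: "h \<in> histories k n \<Longrightarrow> reachable k n (h n)"
proof (induction n arbitrary: h)
  case 0
  then show ?case using reachable.initial[of k] by simp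
next
  case (Suc n)
  then show ?case using reachable.step[OF Suc.IH] by (elim histories_SucE) simp
qed

lemma histories_beyond: "h \<in> histories k n \<Longrightarrow> n < j \<Longrightarrow> h j = {}"
proof (induction n arbitrary: h)
  case (Suc n)
  from Suc.prems(1) show ?case
    by (rule histories_SucE) (use Suc in simp)
qed simp

lemma finite_simplices: "reachable k n K \<Longrightarrow> finite (simplices m K)"
  using reachable_complex(1) by (simp add: simplices_def)

lemma finite_histories: "finite (histories k n)"
proof (induction n)
  case (Suc n)
  then show ?case
    unfolding histories.simps
    by (intro finite_imageI finite_SigmaI) (auto intro: finite_simplices[OF histories_reachable])
qed simp

text \<open>The choice is recovered as the union of all faces through the new vertex, with that
  vertex removed.\<close>

lemma attach_inj:
  assumes K: "reachable k n K" and "\<sigma> \<in> simplices k K" "\<sigma>' \<in> simplices k K"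
    and eq: "attach (n + 1 + k + 2) K \<sigma> = attach (n + 1 + k + 2) K \<sigma>'"
  shows "\<sigma> = \<sigma>'"
proof -
  define v where "v = n + 1 + k + 2"
  have "\<Union>{\<rho> \<in> attach v K \<sigma>. v \<in> \<rho>} - {v} = \<sigma>" if "\<sigma> \<in> simplices k K" for \<sigma>
  proof -
    have v: "v \<notin> \<rho>" if "\<rho> \<in> K" for \<rho> using new_vertex_notin[OF K that] by (simp add: v_def)
    then have "{\<rho> \<in> attach v K \<sigma>. v \<in> \<rho>} = {\<rho>. \<rho> \<subseteq> insert v \<sigma> \<and> v \<in> \<rho>}"
      by (auto simp: attach_def full_simplex_def)
    moreover have "\<Union>{\<rho>. \<rho> \<subseteq> insert v \<sigma> \<and> v \<in> \<rho>} = insert v \<sigma>" by blast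
    moreover have "v \<notin> \<sigma>" using v that by (simp add: simplices_def)
    ultimately show ?thesis by simp
  qed
  then show ?thesis using assms eq unfolding v_def by metis
qed

lemma inj_on_histories:
  "inj_on (\<lambda>(h, \<sigma>). h(Suc n := attach (n + 1 + k + 2) (h n) \<sigma>))
    (SIGMA h : histories k n. simplices k (h n))"
proof (rule inj_onI, clarify)
  fix h \<sigma> h' \<sigma>'
  assume h: "h \<in> histories k n" "h' \<in> histories k n"
    and s: "\<sigma> \<in> simplices k (h n)" "\<sigma>' \<in> simplices k (h' n)"
    and eq: "h(Suc n := attach (n + 1 + k + 2) (h n) \<sigma>) = h'(Suc n := attach (n + 1 + k + 2) (h' n) \<sigma>')"
  have "h j = h' j" for j
  proof (cases "j = Suc n")
    case True
    then show ?thesis using histories_beyond[OF h(1), of j] histories_beyond[OF h(2), of j] by simp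
  next
    case False
    then show ?thesis using fun_cong[OF eq, of j] by simp
  qed
  then have hh: "h = h'" by auto
  moreover have "\<sigma> = \<sigma>'"
    using attach_inj[OF histories_reachable[OF h(1)] s(1), of \<sigma>'] s(2) fun_cong[OF eq, of "Suc n"] hh
    by simp
  ultimately show "h = h' \<and> \<sigma> = \<sigma>'" by simp
qed

text \<open>Every path has a unique predecessor and a unique last choice. This splitting takes the
  place of conditioning on the first n steps.\<close>

lemma sum_histories_Suc:
  "(\<Sum>h\<in>histories k (Suc n). f h)
    = (\<Sum>h\<in>histories k n. \<Sum>\<sigma>\<in>simplices k (h n). f (h(Suc n := attach (n + 1 + k + 2) (h n) \<sigma>)))"
proof -
  have "(\<Sum>h\<in>histories k (Suc n). f h)
      = (\<Sum>(h, \<sigma>)\<in>(SIGMA h : histories k n. simplices k (h n)). f (h(Suc n := attach (n + 1 + k + 2) (h n) \<sigma>)))"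
    unfolding histories.simps by (subst sum.reindex[OF inj_on_histories]) (simp add: case_prod_unfold)
  also have "\<dots> = (\<Sum>h\<in>histories k n. \<Sum>\<sigma>\<in>simplices k (h n). f (h(Suc n := attach (n + 1 + k + 2) (h n) \<sigma>)))"
    by (rule sum.Sigma[symmetric]) (auto intro: finite_histories finite_simplices histories_reachable)
  finally show ?thesis .
qed

section \<open>Law of one choice and conditional mean of the next count\<close>

definition choice_prob :: "nat \<Rightarrow> real \<Rightarrow> nat \<Rightarrow> nat set set \<Rightarrow> nat set \<Rightarrow> real" where
  "choice_prob k \<delta> n K \<sigma> = (real (face_degree k K \<sigma>) + \<delta>) / ((real n + 1) * tau k \<delta> + \<delta>)"

lemma total_weight_pos:
  assumes "\<delta> > -1"
  shows "(real n + 1) * tau k \<delta> + \<delta> > 0"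
proof -
  have "0 \<le> real n * tau k \<delta>" using tau_pos(1)[OF assms, of k] by simp
  then show ?thesis using tau_pos(2)[OF assms, of k] by (simp add: algebra_simps)
qed

lemma choice_prob_nonneg:
  assumes "\<delta> > -1" "reachable k n K" "\<sigma> \<in> simplices k K"
  shows "choice_prob k \<delta> n K \<sigma> \<ge> 0"
  using weight_pos[OF assms(2,3,1)] total_weight_pos[OF assms(1), of n k] by (simp add: choice_prob_def)

lemma sum_choice_prob:
  assumes "\<delta> > -1" "reachable k n K"
  shows "(\<Sum>\<sigma>\<in>simplices k K. choice_prob k \<delta> n K \<sigma>) = 1"
  unfolding choice_prob_def sum_divide_distrib[symmetric] sum_weight_simplices[OF assms(2)]
  using total_weight_pos[OF assms(1), of n k] by simp

definition expected_count :: "nat \<Rightarrow> real \<Rightarrow> nat list \<Rightarrow> nat \<Rightarrow> nat set set \<Rightarrow> real" where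
  "expected_count k \<delta> is n K =
    (\<Sum>\<sigma>\<in>simplices k K. choice_prob k \<delta> n K \<sigma> * degree_count k (attach (n + 1 + k + 2) K \<sigma>) is)"

text \<open>Arranged as a factor 1 - a n on the current count plus inflow from lower tuples, the
  form treated by \<open>linear_recursion_limit\<close>.\<close>

lemma expected_count_eq:
  assumes \<delta>: "\<delta> > -1" and K: "reachable k n K" and I: "is \<in> degree_indices k"
  shows "expected_count k \<delta> is n K
    = (1 - exit_rate k \<delta> is / ((real n + 1) * tau k \<delta> + \<delta>)) * degree_count k K is
      + ((\<Sum>m\<le>k. rate k \<delta> m is / ((real n + 1) * tau k \<delta> + \<delta>) * degree_count k K (lower (m + 1) is))
        + real (k + 1) * of_bool (root_index k is))"
proof -
  define T where "T = (real n + 1) * tau k \<delta> + \<delta>"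
  have T: "T > 0" using total_weight_pos[OF \<delta>] by (simp add: T_def)
  have "expected_count k \<delta> is n K
      = (\<Sum>\<sigma>\<in>simplices k K. (real (face_degree k K \<sigma>) + \<delta>) * degree_count k (attach (n + 1 + k + 2) K \<sigma>) is) / T"
    by (simp add: expected_count_def choice_prob_def T_def sum_divide_distrib)
  also have "\<dots> = (T * (degree_count k K is + real (k + 1) * of_bool (root_index k is))
      + (\<Sum>m\<le>k. rate k \<delta> m is * degree_count k K (lower (m + 1) is))
      - exit_rate k \<delta> is * degree_count k K is) / T"
    unfolding T_def by (subst sum_weight_degree_count_attach[OF K I]) simp
  also have "\<dots> = (1 - exit_rate k \<delta> is / T) * degree_count k K is
      + ((\<Sum>m\<le>k. rate k \<delta> m is / T * degree_count k K (lower (m + 1) is))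
        + real (k + 1) * of_bool (root_index k is))"
    using T by (simp add: add_divide_distrib diff_divide_distrib sum_divide_distrib algebra_simps)
  finally show ?thesis unfolding T_def .
qed

lemma expected_count_diff:
  assumes \<delta>: "\<delta> > -1" and K: "reachable k n K" and I: "is \<in> degree_indices k"
  shows "\<bar>expected_count k \<delta> is n K - degree_count k K is\<bar>
    \<le> real ((k + 1) * (1 + k * (is ! 0)) + (k + 1))"
proof -
  let ?B = "real ((k + 1) * (1 + k * (is ! 0)) + (k + 1))"
  have "expected_count k \<delta> is n K - degree_count k K is = (\<Sum>\<sigma>\<in>simplices k K. choice_prob k \<delta> n K \<sigma>
      * (real (degree_count k (attach (n + 1 + k + 2) K \<sigma>) is) - degree_count k K is))"
    using sum_choice_prob[OF \<delta> K]
    by (simp add: expected_count_def right_diff_distrib sum_subtractf sum_distrib_right[symmetric])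
  also have "\<bar>\<dots>\<bar> \<le> (\<Sum>\<sigma>\<in>simplices k K. choice_prob k \<delta> n K \<sigma> * ?B)"
  proof (rule order.trans[OF sum_abs sum_mono])
    fix \<sigma> assume s: "\<sigma> \<in> simplices k K"
    show "\<bar>choice_prob k \<delta> n K \<sigma> * (real (degree_count k (attach (n + 1 + k + 2) K \<sigma>) is) - degree_count k K is)\<bar>
        \<le> choice_prob k \<delta> n K \<sigma> * ?B"
      unfolding abs_mult using degree_count_attach_diff[OF K s refl I] choice_prob_nonneg[OF \<delta> K s]
      by (simp only: abs_of_nonneg mult_left_mono)
  qed
  also have "\<dots> = ?B" using sum_choice_prob[OF \<delta> K] by (simp only: sum_distrib_right[symmetric] mult_1)
  finally show ?thesis .
qed

lemma degree_count_outside: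
  assumes "reachable k n K" "length is = k + 1" "is \<notin> degree_indices k"
  shows "degree_count k K is = 0"
proof -
  have "{\<rho> \<in> simplices k K. degree_vector k K \<rho> = is} = {}"
    using degree_vector_in_degree_indices[OF assms(1)] assms(3) by auto
  then show ?thesis unfolding degree_count_eq[OF assms(2)] by (simp only: card.empty)
qed

context preferential_attachment_complex
begin

definition history :: "nat \<Rightarrow> 'a \<Rightarrow> nat \<Rightarrow> nat set set" where
  "history n \<omega> = (\<lambda>j. if j \<le> n then G j \<omega> else {})"

definition cylinder :: "nat \<Rightarrow> (nat \<Rightarrow> nat set set) \<Rightarrow> 'a set" where
  "cylinder n h = {\<omega> \<in> space M. \<forall>j\<le>n. G j \<omega> = h j}"

text \<open>All subsets of the countable state space are measurable, so \<open>f\<close> may be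
  arbitrary.\<close>

lemma measurable_G_comp [measurable]: "(\<lambda>\<omega>. f (G n \<omega>) :: real) \<in> borel_measurable M"
  by (rule measurable_compose[OF random_complex]) simp

lemma sets_G_eq [measurable]: "{\<omega> \<in> space M. G n \<omega> = K} \<in> sets M"
proof -
  have "{\<omega> \<in> space M. G n \<omega> = K} = (\<lambda>\<omega>. of_bool (G n \<omega> = K) :: real) -` {1} \<inter> space M"
    by auto
  also have "\<dots> \<in> sets M" by (rule measurable_sets[OF measurable_G_comp]) simp
  finally show ?thesis .
qed

lemma sets_cylinder [measurable]: "cylinder n h \<in> sets M"
proof -
  have "cylinder n h = {\<omega> \<in> space M. \<forall>j\<in>{..n}. G j \<omega> = h j}" by (auto simp: cylinder_def)
  also have "\<dots> \<in> sets M" by (intro sets.sets_Collect_finite_All sets_G_eq finite_atMost)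
  finally show ?thesis .
qed

lemma history_eq_iff:
  assumes "h \<in> histories k n" "\<omega> \<in> space M"
  shows "history n \<omega> = h \<longleftrightarrow> \<omega> \<in> cylinder n h"
  using assms histories_beyond[OF assms(1)]
  by (auto simp: history_def cylinder_def fun_eq_iff)

text \<open>The attachment law speaks only of histories of positive probability; for a null history
  both sides are 0.\<close>

lemma prob_cylinder_Suc:
  assumes h: "h \<in> histories k n" and \<sigma>: "\<sigma> \<in> simplices k (h n)"
  shows "prob (cylinder (Suc n) (h(Suc n := attach (n + 1 + k + 2) (h n) \<sigma>)))
    = prob (cylinder n h) * choice_prob k \<delta> n (h n) \<sigma>"
proof -
  let ?h' = "h(Suc n := attach (n + 1 + k + 2) (h n) \<sigma>)"
  have eq: "cylinder (Suc n) ?h' = {\<omega> \<in> space M. G (n + 1) \<omega> = h n \<union> full_simplex (insert ((n + 1) + k + 2) \<sigma>)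
      \<and> (\<forall>j\<le>n. G j \<omega> = h j)}"
    by (auto simp: cylinder_def attach_def le_Suc_eq)
  show ?thesis
  proof (cases "prob (cylinder n h) > 0")
    case True
    have "prob (cylinder (Suc n) ?h') / prob (cylinder n h) = choice_prob k \<delta> n (h n) \<sigma>"
      using attachment[of n h \<sigma>] True \<sigma> sum_weight_simplices[OF histories_reachable[OF h], of \<delta>]
      unfolding eq unfolding choice_prob_def cond_prob_def cylinder_def by simp
    then show ?thesis using True by (simp add: field_simps)
  next
    case False
    then have z: "prob (cylinder n h) = 0" by (simp add: zero_less_measure_iff)
    have "cylinder (Suc n) ?h' \<subseteq> cylinder n h" by (auto simp: eq cylinder_def)
    then have "prob (cylinder (Suc n) ?h') \<le> prob (cylinder n h)" by (intro finite_measure_mono) auto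
    then show ?thesis using z by (simp add: measure_le_0_iff)
  qed
qed

text \<open>The attachment law prescribes only the intended successors. Their probabilities already
  add up to one, so nothing else happens with positive probability.\<close>

lemma sum_prob_cylinder:
  assumes \<delta>: "\<delta> > -1"
  shows "(\<Sum>h\<in>histories k n. prob (cylinder n h)) = 1"
proof (induction n)
  case 0
  have "AE \<omega> in M. \<omega> \<in> cylinder 0 (\<lambda>j. if j = 0 then full_simplex {1..k + 2} else {})"
    using initial AE_space by eventually_elim (simp add: cylinder_def)
  then show ?case using prob_eq_1[OF sets_cylinder] by simp
next
  case (Suc n)
  have "(\<Sum>h\<in>histories k (Suc n). prob (cylinder (Suc n) h))
      = (\<Sum>h\<in>histories k n. \<Sum>\<sigma>\<in>simplices k (h n). prob (cylinder n h) * choice_prob k \<delta> n (h n) \<sigma>)"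
    unfolding sum_histories_Suc by (intro sum.cong refl prob_cylinder_Suc)
  also have "\<dots> = (\<Sum>h\<in>histories k n. prob (cylinder n h))"
    by (intro sum.cong refl) (simp add: sum_distrib_left[symmetric] sum_choice_prob[OF \<delta> histories_reachable])
  finally show ?case using Suc by simp
qed

lemma AE_history:
  assumes \<delta>: "\<delta> > -1"
  shows "AE \<omega> in M. history n \<omega> \<in> histories k n"
proof -
  have "disjoint_family_on (cylinder n) (histories k n)"
    unfolding disjoint_family_on_def
    using history_eq_iff sets.sets_into_space[OF sets_cylinder] by blast
  then have "prob (\<Union>h\<in>histories k n. cylinder n h) = 1"
    using finite_measure_finite_Union[OF finite_histories, of "cylinder n" k n] sum_prob_cylinder[OF \<delta>, of n]
    by (simp add: image_subset_iff)
  then have "AE \<omega> in M. \<omega> \<in> (\<Union>h\<in>histories k n. cylinder n h)"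
    by (rule AE_prob_1)
  then show ?thesis using AE_space
  proof eventually_elim
    case (elim \<omega>)
    then obtain h where "h \<in> histories k n" "\<omega> \<in> cylinder n h" by blast
    then show ?case using history_eq_iff elim(2) by blast
  qed
qed

lemma expectation_history:
  assumes \<delta>: "\<delta> > -1" and [measurable]: "(\<lambda>\<omega>. F (history n \<omega>)) \<in> borel_measurable M"
  shows "expectation (\<lambda>\<omega>. F (history n \<omega>)) = (\<Sum>h\<in>histories k n. F h * prob (cylinder n h))"
proof -
  have "expectation (\<lambda>\<omega>. F (history n \<omega>)) = expectation (\<lambda>\<omega>. \<Sum>h\<in>histories k n. F h * indicator (cylinder n h) \<omega>)"
  proof (rule integral_cong_AE)
    show "AE \<omega> in M. F (history n \<omega>) = (\<Sum>h\<in>histories k n. F h * indicator (cylinder n h) \<omega>)"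
      using AE_history[OF \<delta>, of n] AE_space
    proof eventually_elim
      case (elim \<omega>)
      have "(\<Sum>h\<in>histories k n. F h * indicator (cylinder n h) \<omega>)
          = (\<Sum>h\<in>histories k n. if h = history n \<omega> then F h else 0)"
        using history_eq_iff elim(2) by (intro sum.cong) (auto simp: indicator_def)
      then show ?case using elim(1) finite_histories by simp
    qed
  qed measurable
  also have "\<dots> = (\<Sum>h\<in>histories k n. F h * prob (cylinder n h))"
    by (subst Bochner_Integration.integral_sum)
      (auto intro!: integrable_mult_right integrable_real_indicator simp: less_top[symmetric])
  finally show ?thesis .
qed

section \<open>Centred increments and almost sure limits of the counts\<close>

definition noise :: "nat list \<Rightarrow> nat \<Rightarrow> 'a \<Rightarrow> real" where
  "noise is n \<omega> = degree_count k (G (Suc n) \<omega>) is - expected_count k \<delta> is n (G n \<omega>)"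

lemma measurable_noise [measurable]: "noise is n \<in> borel_measurable M"
  unfolding noise_def by measurable

text \<open>Both the next count and its conditional mean lie within the one-step bound of the
  current count, hence the factor 2.\<close>

lemma noise_bound:
  assumes \<delta>: "\<delta> > -1" and I: "is \<in> degree_indices k"
  shows "AE \<omega> in M. \<bar>noise is n \<omega>\<bar> \<le> 2 * real ((k + 1) * (1 + k * (is ! 0)) + (k + 1))"
  using AE_history[OF \<delta>, of "Suc n"]
proof eventually_elim
  case (elim \<omega>)
  then obtain h \<sigma> where h: "h \<in> histories k n" "\<sigma> \<in> simplices k (h n)"
    and eq: "history (Suc n) \<omega> = h(Suc n := attach (n + 1 + k + 2) (h n) \<sigma>)" by auto
  have G: "G (Suc n) \<omega> = attach (n + 1 + k + 2) (h n) \<sigma>" "G n \<omega> = h n"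
    using fun_cong[OF eq, of "Suc n"] fun_cong[OF eq, of n] by (simp_all add: history_def)
  define B where "B = real ((k + 1) * (1 + k * (is ! 0)) + (k + 1))"
  have "\<bar>noise is n \<omega>\<bar> \<le> 2 * B"
    using degree_count_attach_diff[OF histories_reachable[OF h(1)] h(2) refl I, folded B_def]
      expected_count_diff[OF \<delta> histories_reachable[OF h(1)] I, folded B_def]
    unfolding noise_def G by linarith
  then show ?case by (simp only: B_def)
qed

text \<open>As i + 1 \<le> j, the earlier noise is fixed by the history up to time j and factors
  out; the sum over the choice at time j is then 0.\<close>

lemma noise_orthogonal:
  assumes \<delta>: "\<delta> > -1" and ij: "i < j"
  shows "expectation (\<lambda>\<omega>. noise is i \<omega> * noise is j \<omega>) = 0"
proof -
  define N where "N K = real (degree_count k K is)" for K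
  define \<Phi> where "\<Phi> = expected_count k \<delta> is"
  define F where "F h = (N (h (Suc i)) - \<Phi> i (h i)) * (N (h (Suc j)) - \<Phi> j (h j))"
    for h :: "nat \<Rightarrow> nat set set"
  have F: "F (history (Suc j) \<omega>) = noise is i \<omega> * noise is j \<omega>" for \<omega>
    using ij by (simp add: F_def history_def noise_def N_def \<Phi>_def)
  have "expectation (\<lambda>\<omega>. noise is i \<omega> * noise is j \<omega>)
      = (\<Sum>h\<in>histories k (Suc j). F h * prob (cylinder (Suc j) h))"
    unfolding F[symmetric] by (rule expectation_history[OF \<delta>]) (simp add: F)
  also have "\<dots> = (\<Sum>h\<in>histories k j. \<Sum>\<sigma>\<in>simplices k (h j).
      (N (h (Suc i)) - \<Phi> i (h i)) * prob (cylinder j h)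
        * (choice_prob k \<delta> j (h j) \<sigma> * (N (attach (j + 1 + k + 2) (h j) \<sigma>) - \<Phi> j (h j))))"
    unfolding sum_histories_Suc
    by (intro sum.cong refl, subst prob_cylinder_Suc) (use ij in \<open>auto simp: F_def\<close>)
  also have "\<dots> = (\<Sum>h\<in>histories k j. 0)"
  proof (intro sum.cong refl)
    fix h assume h: "h \<in> histories k j"
    have "(\<Sum>\<sigma>\<in>simplices k (h j). choice_prob k \<delta> j (h j) \<sigma> * (N (attach (j + 1 + k + 2) (h j) \<sigma>) - \<Phi> j (h j))) = 0"
      using sum_choice_prob[OF \<delta> histories_reachable[OF h]]
      by (simp add: right_diff_distrib sum_subtractf sum_distrib_right[symmetric] \<Phi>_def expected_count_def N_def)
    then show "(\<Sum>\<sigma>\<in>simplices k (h j). (N (h (Suc i)) - \<Phi> i (h i)) * prob (cylinder j h)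
        * (choice_prob k \<delta> j (h j) \<sigma> * (N (attach (j + 1 + k + 2) (h j) \<sigma>) - \<Phi> j (h j)))) = 0"
      by (simp only: sum_distrib_left[symmetric] mult_zero_right)
  qed
  finally show ?thesis by simp
qed

text \<open>Induction on the first index: all lowered tuples have a smaller one, or are inadmissible
  with count 0. The factor k + 1 is the number of k-simplices gained per step.\<close>

lemma degree_count_linear_growth:
  assumes \<delta>: "\<delta> > -1" and rec: "degree_recursion k \<delta> p" and "is \<in> degree_indices k"
  shows "AE \<omega> in M. (\<lambda>n. degree_count k (G n \<omega>) is / (real n + 1)) \<longlonglongrightarrow> real (k + 1) * p is"
  using assms(3)
proof (induction "is ! 0" arbitrary: "is" rule: less_induct)
  case less
  note I = less.prems
  have len: "length is = k + 1" using I by (simp add: degree_indices_def)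
  have AEr: "AE \<omega> in M. \<forall>n. reachable k n (G n \<omega>)"
  proof (subst AE_all_countable, rule allI)
    fix n
    show "AE \<omega> in M. reachable k n (G n \<omega>)"
      using AE_history[OF \<delta>, of n]
      by eventually_elim (drule histories_reachable, simp add: history_def)
  qed
  have IH: "AE \<omega> in M. (\<lambda>n. degree_count k (G n \<omega>) (lower (m + 1) is) / (real n + 1))
      \<longlonglongrightarrow> real (k + 1) * zero_ext k p (lower (m + 1) is)" for m
  proof (cases "lower (m + 1) is \<in> degree_indices k")
    case True
    then show ?thesis
      using less.hyps[OF _ True] lower_nth_0_less[OF I, of m] by (simp add: zero_ext_def)
  next
    case False
    show ?thesis using AEr
    proof eventually_elim
      case (elim \<omega>)
      have "degree_count k (G n \<omega>) (lower (m + 1) is) = 0" for n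
        using degree_count_outside[OF elim[rule_format, of n] _ False] len by simp
      then show ?case using False by (simp add: zero_ext_def)
    qed
  qed
  have "AE \<omega> in M. \<forall>m\<in>{..k}. (\<lambda>n. degree_count k (G n \<omega>) (lower (m + 1) is) / (real n + 1))
      \<longlonglongrightarrow> real (k + 1) * zero_ext k p (lower (m + 1) is)"
    using IH by (subst AE_finite_all) auto
  moreover have "AE \<omega> in M. (\<lambda>n. (\<Sum>j<n. noise is j \<omega>) / (real n + 1)) \<longlonglongrightarrow> 0"
    by (rule strong_law_orthogonal[OF measurable_noise noise_bound[OF \<delta> I] noise_orthogonal[OF \<delta>]])
  ultimately show ?case using AEr
  proof eventually_elim
    case (elim \<omega>)
    define T where "T n = (real n + 1) * tau k \<delta> + \<delta>" for n
    define N where "N js n = real (degree_count k (G n \<omega>) js)" for js n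
    have T: "T n > 0" for n unfolding T_def by (rule total_weight_pos[OF \<delta>])
    have \<tau>: "tau k \<delta> > 0" using tau_pos(1)[OF \<delta>] .
    have inv: "(\<lambda>n. (real n + 1) / T n) \<longlonglongrightarrow> 1 / tau k \<delta>"
    proof -
      have "(\<lambda>n. inverse (tau k \<delta> + \<delta> * inverse (real (Suc n)))) \<longlonglongrightarrow> inverse (tau k \<delta> + \<delta> * 0)"
        using \<tau> by (intro tendsto_intros LIMSEQ_inverse_real_of_nat) simp
      moreover have "inverse (tau k \<delta> + \<delta> * inverse (real (Suc n))) = (real n + 1) / T n" for n
      proof -
        have "tau k \<delta> + \<delta> * inverse (real (Suc n)) = T n / (real n + 1)"
          by (simp add: T_def field_simps)
        then show ?thesis by (simp only: inverse_divide)
      qed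
      ultimately show ?thesis by (simp add: inverse_eq_divide)
    qed
    have ratio: "(\<lambda>n. (real n + 1) * (c / T n)) \<longlonglongrightarrow> c / tau k \<delta>" for c
      using tendsto_mult_left[OF inv, of c] by (simp add: mult.commute)
    have low: "(\<lambda>n. c / T n * N (lower (m + 1) is) n)
        \<longlonglongrightarrow> c / tau k \<delta> * (real (k + 1) * zero_ext k p (lower (m + 1) is))" if "m \<in> {..k}" for m c
    proof -
      have "(\<lambda>n. (real n + 1) * (c / T n) * (N (lower (m + 1) is) n / (real n + 1)))
          \<longlonglongrightarrow> c / tau k \<delta> * (real (k + 1) * zero_ext k p (lower (m + 1) is))"
        using elim(1) that unfolding N_def by (intro tendsto_mult ratio) blast
      moreover have "(real n + 1) * (c / T n) * (N (lower (m + 1) is) n / (real n + 1))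
          = c / T n * N (lower (m + 1) is) n" for n
        by (simp add: of_nat_neq_0 add.commute)
      ultimately show ?thesis by simp
    qed
    define \<beta> where "\<beta> n = (\<Sum>m\<le>k. rate k \<delta> m is / T n * N (lower (m + 1) is) n)
        + real (k + 1) * of_bool (root_index k is)" for n
    have step: "N is (Suc n) = (1 - exit_rate k \<delta> is / T n) * N is n + \<beta> n + noise is n \<omega>" for n
      using expected_count_eq[OF \<delta> elim(3)[rule_format, of n] I]
      by (simp add: noise_def N_def \<beta>_def T_def)
    \<comment> \<open>The limit of the inflow is the right-hand side of the recursion times k + 1,
      which identifies the limit of the count.\<close>
    have "\<beta> \<longlonglongrightarrow> (\<Sum>m\<le>k. rate k \<delta> m is / tau k \<delta> * (real (k + 1) * zero_ext k p (lower (m + 1) is)))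
        + real (k + 1) * of_bool (root_index k is)"
      unfolding \<beta>_def by (intro tendsto_add tendsto_sum low tendsto_const)
    also have "(\<Sum>m\<le>k. rate k \<delta> m is / tau k \<delta> * (real (k + 1) * zero_ext k p (lower (m + 1) is)))
        + real (k + 1) * of_bool (root_index k is)
        = real (k + 1) * ((1 + exit_rate k \<delta> is / tau k \<delta>) * p is)"
      unfolding degree_recursion_rate[OF rec I] distrib_left sum_distrib_left by (simp only: mult_ac)
    finally have \<beta>: "\<beta> \<longlonglongrightarrow> (1 + exit_rate k \<delta> is / tau k \<delta>) * (real (k + 1) * p is)"
      by (simp only: mult_ac)
    \<comment> \<open>The factor \<open>a n\<close> is of order 1 / n, so it eventually lies in
      [0, 1].\<close>
    have "(\<lambda>n. inverse (real (Suc n)) * ((real n + 1) * (exit_rate k \<delta> is / T n))) \<longlonglongrightarrow> 0 * (exit_rate k \<delta> is / tau k \<delta>)"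
      by (intro tendsto_mult ratio LIMSEQ_inverse_real_of_nat)
    then have "(\<lambda>n. exit_rate k \<delta> is / T n) \<longlonglongrightarrow> 0"
      by (simp add: mult.assoc[symmetric] add.commute)
    then have "\<forall>\<^sub>F n in sequentially. exit_rate k \<delta> is / T n < 1"
      by (rule order_tendstoD) simp
    then have a01: "\<forall>\<^sub>F n in sequentially. 0 \<le> exit_rate k \<delta> is / T n \<and> exit_rate k \<delta> is / T n \<le> 1"
      by eventually_elim (use exit_rate_pos[OF I \<delta>] T in \<open>simp add: less_imp_le\<close>)
    show ?case
      using linear_recursion_limit[OF step a01 ratio \<beta> elim(2)] by (simp add: N_def)
  qed
qed

lemma degree_count_converges:
  assumes \<delta>: "\<delta> > -1" and rec: "degree_recursion k \<delta> p" and I: "is \<in> degree_indices k"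
  shows "AE \<omega> in M. (\<lambda>n. real (degree_count k (G n \<omega>) is) / (1 + (real n + 1) * (real k + 1)))
    \<longlonglongrightarrow> p is"
  using degree_count_linear_growth[OF \<delta> rec I]
proof eventually_elim
  case (elim \<omega>)
  \<comment> \<open>Numerator and denominator are both divided by n + 1.\<close>
  have "(\<lambda>n. (degree_count k (G n \<omega>) is / (real n + 1)) / (inverse (real (Suc n)) + real (k + 1)))
      \<longlonglongrightarrow> (real (k + 1) * p is) / (0 + real (k + 1))"
    by (intro tendsto_divide elim tendsto_add LIMSEQ_inverse_real_of_nat tendsto_const) simp
  moreover have "(real (k + 1) * p is) / (0 + real (k + 1)) = p is" by simp
  moreover have "(degree_count k (G n \<omega>) is / (real n + 1)) / (inverse (real (Suc n)) + real (k + 1))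
      = degree_count k (G n \<omega>) is / (1 + (real n + 1) * (real k + 1))" for n
  proof -
    have "(real n + 1) * (inverse (real (Suc n)) + real (k + 1)) = 1 + (real n + 1) * (real k + 1)"
      by (simp add: distrib_left add.commute)
    then show ?thesis by (simp only: divide_divide_eq_left)
  qed
  ultimately show ?case by (simp only:)
qed

end

theorem theorem2p1:
  fixes k :: nat and \<delta> :: real and p :: "nat list \<Rightarrow> real"
  assumes "\<delta> > -1"
    and "degree_recursion k \<delta> p"
  shows "(\<exists>P :: nat list pmf. \<forall>is. pmf P is = (if is \<in> degree_indices k then p is else 0))
    \<and> (\<forall>(M :: 'a measure) G. preferential_attachment_complex M k \<delta> G \<longrightarrow>
         (\<forall>is\<in>degree_indices k. AE \<omega> in M.
            (\<lambda>n. real (degree_count k (G n \<omega>) is) / (1 + (real n + 1) * (real k + 1)))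
              \<longlonglongrightarrow> p is))"
  using degree_recursion_pmf[OF assms(2,1)]
    preferential_attachment_complex.degree_count_converges[OF _ assms] by blast

end
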